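(* Let $d\ge 2$ and $m=d+2$, let $\mathbf p=\{p_1,\dots,p_m\}$ be nonnegative integers with $p_1\le p_2\le\dots\le p_m$, and let $n$ be a nonnegative integer with $\binom{n+d}{d}=\sum_{q=1}^m\binom{p_q+d}{d}$. Consider the Hermite interpolation scheme $\mathbf p$ of type total degree on $m=d+2$ nodes in $\mathbb R^d$. Then: (1) if $d=2$ and either $p_1=p_2=p_3$, $p_4=p_3+1$, or $p_1=p_2-1$, $p_2=p_3=p_4$, the scheme is almost regular; (2) if $d=3$, $p_1=p_2=p_3=p_4=p_5=1$ and $n=3$, the scheme is almost regular; (3) in all other cases the scheme is singular.
   Context: $\Pi_n^d$ denotes the space of real polynomials in $d$ variables of total degree at most $n$. Let $\mathbf p=\{p_1,\dots,p_m\}$ be nonnegative integers and let $n$ satisfy $\binom{n+d}{d}=\sum_{q=1}^m\binom{p_q+d}{d}$. For a set $\mathcal X=\{X_1,\dots,X_m\}$ of pairwise distinct points in $\mathbb R^d$, the Hermite interpolation problem of type total degree $(\mathbf p,\mathcal X)$ is: find $f\in\Pi_n^d$ with $\frac{\partial^{|\alpha|}f}{\partial x_1^{\alpha_1}\cdots\partial x_d^{\alpha_d}}(X_q)=c_{q,\alpha}$ for all $1\le q\le m$ and all $\alpha\in\mathbb N_0^d$ with $0\le|\alpha|=\alpha_1+\dots+\alpha_d\le p_q$. The problem $(\mathbf p,\mathcal X)$ is regular if it has a unique solution for every choice of real values $c_{q,\alpha}$, and singular otherwise. The scheme $\mathbf p$ is almost regular if $(\mathbf p,\mathcal X)$ is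 regular for almost all $\mathcal X$ (i.e. for Lebesgue-almost every $(X_1,\dots,X_m)\in(\mathbb R^d)^m$), and singular if $(\mathbf p,\mathcal X)$ is singular for all sets $\mathcal X$ of $m$ pairwise distinct points. *)

theory Defs
  imports "HOL-Analysis.Analysis"
begin

definition multi_indices :: "nat \<Rightarrow> ('d::finite \<Rightarrow> nat) set" where
  "multi_indices n = {\<alpha>. (\<Sum>i\<in>UNIV. \<alpha> i) \<le> n}"

lemma finite_multi_indices: "finite (multi_indices n :: ('d::finite \<Rightarrow> nat) set)"
proof (rule finite_subset)
  show "(multi_indices n :: ('d \<Rightarrow> nat) set) \<subseteq> (UNIV :: 'd set) \<rightarrow>\<^sub>E {..n}"
  proof
    fix \<alpha> :: "'d \<Rightarrow> nat"
    assume "\<alpha> \<in> multi_indices n"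
    then have "(\<Sum>i\<in>UNIV. \<alpha> i) \<le> n" by (simp add: multi_indices_def)
    moreover have "\<alpha> i \<le> (\<Sum>i\<in>UNIV. \<alpha> i)" for i
      by (rule member_le_sum) simp_all
    ultimately have "\<alpha> i \<le> n" for i
      using le_trans by blast
    then show "\<alpha> \<in> (UNIV :: 'd set) \<rightarrow>\<^sub>E {..n}" by (simp add: PiE_UNIV_domain)
  qed
  show "finite ((UNIV :: 'd set) \<rightarrow>\<^sub>E {..n})"
    by (rule finite_PiE) auto
qed

text \<open>Real polynomials of total degree at most \<open>n\<close>, as polynomial functions (over the reals a
  polynomial is determined by the function it induces).\<close>

definition polys_total_degree :: "nat \<Rightarrow> (real ^ 'd::finite \<Rightarrow> real) set" where
  "polys_total_degree n =
    {f. \<exists>a. f = (\<lambda>x. \<Sum>\<alpha>\<in>multi_indices n. a \<alpha> * (\<Prod>i\<in>UNIV. (x $ i) ^ \<alpha> i))}"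

definition partial_deriv :: "'d::finite \<Rightarrow> (real ^ 'd \<Rightarrow> real) \<Rightarrow> real ^ 'd \<Rightarrow> real" where
  "partial_deriv i f x = deriv (\<lambda>t. f (x + t *\<^sub>R axis i 1)) 0"

text \<open>A finite index type carries no canonical order, so the coordinates are enumerated by an
  arbitrary but fixed list. For polynomials (indeed for smooth functions) the mixed derivative does
  not depend on the order.\<close>

definition coord_list :: "'d::finite list" where
  "coord_list = (SOME is. distinct is \<and> set is = UNIV)"

definition mixed_deriv :: "('d::finite \<Rightarrow> nat) \<Rightarrow> (real ^ 'd \<Rightarrow> real) \<Rightarrow> real ^ 'd \<Rightarrow> real" where
  "mixed_deriv \<alpha> f = foldr (\<lambda>i g. (partial_deriv i ^^ \<alpha> i) g) coord_list f"

text \<open>The nodes \<open>X\<close> and the orders \<open>p\<close> are indexed by \<open>1, \<dots>, m\<close>. If two nodes coincide, the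
  interpolation conditions at that point conflict for some data, so \<open>hermite_regular\<close> is false
  there; hence distinctness need not be required separately in \<open>almost_regular\<close>.\<close>

definition hermite_regular :: "nat \<Rightarrow> nat \<Rightarrow> (nat \<Rightarrow> nat) \<Rightarrow> (nat \<Rightarrow> real ^ 'd::finite) \<Rightarrow> bool" where
  "hermite_regular n m p X \<longleftrightarrow>
    (\<forall>c :: nat \<Rightarrow> ('d \<Rightarrow> nat) \<Rightarrow> real.
      \<exists>!f. f \<in> polys_total_degree n \<and>
        (\<forall>q\<in>{1..m}. \<forall>\<alpha>\<in>multi_indices (p q). mixed_deriv \<alpha> f (X q) = c q \<alpha>))"

definition almost_regular :: "'d::finite itself \<Rightarrow> nat \<Rightarrow> nat \<Rightarrow> (nat \<Rightarrow> nat) \<Rightarrow> bool" where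
  "almost_regular _ n m p \<longleftrightarrow>
    (AE X :: nat \<Rightarrow> real ^ 'd in (\<Pi>\<^sub>M q\<in>{1..m}. lborel). hermite_regular n m p X)"

definition singular_scheme :: "'d::finite itself \<Rightarrow> nat \<Rightarrow> nat \<Rightarrow> (nat \<Rightarrow> nat) \<Rightarrow> bool" where
  "singular_scheme _ n m p \<longleftrightarrow>
    (\<forall>X :: nat \<Rightarrow> real ^ 'd. inj_on X {1..m} \<longrightarrow> \<not> hermite_regular n m p X)"

end

theory Submission
  imports Defs
begin

text \<open>
  Write \<open>d = CARD('d)\<close> and \<open>N q = p q + 1\<close>; the conditions at the node \<open>X q\<close> say that \<open>f\<close> vanishes
  there to order \<open>N q\<close> when the data are zero.

  \<^bold>\<open>Singularity.\<close> Two obstructions exist for every choice of the nodes. If \<open>N a + N b \<ge> n + 2\<close> for two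
  nodes, then the restriction of \<open>f\<close> to the line through them is a univariate polynomial of degree
  at most \<open>n\<close> on which more than \<open>n + 1\<close> conditions are imposed, so some data are not attained
  (\<open>not_hermite_regular_if_line_overdetermined\<close>). If all \<open>N q \<le> n\<close> and the \<open>N q\<close> add up to at most
  \<open>d n\<close>, then \<open>n\<close> hyperplanes, each through at most \<open>d\<close> nodes, can be chosen so that \<open>X q\<close> lies on
  at least \<open>N q\<close> of them, and the product of their equations is a nonzero polynomial in the kernel
  (\<open>not_hermite_regular_if_hyperplanes\<close>). If neither obstruction occurs, every pair satisfies
  \<open>N a + N b \<le> n + 1\<close>, hence \<open>d n + 1 \<le> \<Sum> N q \<le> (d + 2) (n + 1) / 2\<close>; this forces \<open>(d - 2) n \<le> d\<close>
  and, together with the dimension count, leaves only the exceptional schemes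
  (\<open>exceptional_if_unobstructed\<close>).

  \<^bold>\<open>Regularity.\<close> The interpolation system is square, so it suffices that the kernel is trivial
  (\<open>hermite_regular_if_kernel_0\<close>), and this is shown for all nodes in general position. In the plane
  one peels off lines by Bezout's argument: a line meeting \<open>f\<close> in more than \<open>deg f\<close> points (counted
  with multiplicity) is a component of \<open>f\<close>, and dividing by its equation lowers the degree and the
  two orders by one. For four nodes in general position the orders \<open>(N, N, N, N + 1)\<close> in degree
  \<open>2 N\<close> are reduced by the three lines through the last node to \<open>(N - 1, N - 1, N - 1, N - 2)\<close> in
  degree \<open>2 N - 3\<close>, and these, by the three sides of the remaining triangle, to the first type with
  \<open>N - 3\<close> in place of \<open>N\<close> (\<open>quadrangle_unisolvent_A\<close>, \<open>quadrangle_unisolvent_B\<close>). For a cubic in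
  space with five double points, these two planar results show that it contains the plane through
  three of the points, and then that the remaining quadric contains another such plane; what is left
  is an affine function with a double zero (\<open>cubic_five_double_points\<close>).

  General position is the non-vanishing of finitely many determinants of differences of nodes. Such
  a determinant is nonzero almost everywhere because along a suitable direction in configuration
  space it is, up to sign, the characteristic polynomial of a matrix, and the product Lebesgue
  measure is invariant under translations (\<open>AE_det_differences\<close>).
\<close>

section \<open>Polynomial functions graded by total degree\<close>

definition monomial :: "('d::finite \<Rightarrow> nat) \<Rightarrow> real ^ 'd \<Rightarrow> real" where
  "monomial \<alpha> x = (\<Prod>i\<in>UNIV. (x $ i) ^ \<alpha> i)"

definition poly_space :: "('d::finite \<Rightarrow> nat) set \<Rightarrow> (real ^ 'd \<Rightarrow> real) set" where
  "poly_space A = {f. \<exists>a. f = (\<lambda>x. \<Sum>\<alpha>\<in>A. a \<alpha> * monomial \<alpha> x)}"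

text \<open>The range of degrees is half-open so that the polynomials of degree less than \<open>s\<close> form a space
  also for \<open>s = 0\<close>, namely the zero space. Division by a linear form then lowers \<open>s\<close>
  by one, truncated at zero, without a separate case for constants.\<close>

definition degs :: "nat \<Rightarrow> nat \<Rightarrow> ('d::finite \<Rightarrow> nat) set" where
  "degs k s = {\<alpha>. k \<le> sum \<alpha> UNIV \<and> sum \<alpha> UNIV < s}"

abbreviation polys :: "nat \<Rightarrow> (real ^ 'd::finite \<Rightarrow> real) set" where
  "polys s \<equiv> poly_space (degs 0 s)"

lemma degs_iff [simp]: "\<alpha> \<in> degs k s \<longleftrightarrow> k \<le> sum \<alpha> UNIV \<and> sum \<alpha> UNIV < s"
  by (simp add: degs_def)

lemma finite_degs [simp]: "finite (degs k s)"
  by (rule finite_subset[OF _ finite_multi_indices[of s]]) (auto simp: degs_def multi_indices_def)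

lemma polys_total_degree_eq: "polys_total_degree n = polys (Suc n)"
proof -
  have "(multi_indices n :: ('a \<Rightarrow> nat) set) = degs 0 (Suc n)"
    by (auto simp: multi_indices_def degs_def)
  then show ?thesis
    unfolding polys_total_degree_def poly_space_def monomial_def by simp
qed

lemma poly_space_mono:
  assumes "f \<in> poly_space A" "A \<subseteq> B" "finite B"
  shows "f \<in> poly_space B"
proof -
  obtain a where a: "f = (\<lambda>x. \<Sum>\<alpha>\<in>A. a \<alpha> * monomial \<alpha> x)"
    using assms(1) unfolding poly_space_def by auto
  have "f = (\<lambda>x. \<Sum>\<alpha>\<in>B. (if \<alpha> \<in> A then a \<alpha> else 0) * monomial \<alpha> x)"
    unfolding a using assms(2,3) by (intro ext sum.mono_neutral_cong_left) auto
  then show ?thesis unfolding poly_space_def by (auto intro!: exI)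
qed

lemma poly_space_0: "(\<lambda>x. 0) \<in> poly_space A"
  unfolding poly_space_def by (auto intro!: exI[of _ "\<lambda>_. 0"])

lemma poly_space_add:
  assumes "f \<in> poly_space A" "g \<in> poly_space A"
  shows "(\<lambda>x. f x + g x) \<in> poly_space A"
proof -
  obtain a where a: "f = (\<lambda>x. \<Sum>\<alpha>\<in>A. a \<alpha> * monomial \<alpha> x)"
    using assms(1) unfolding poly_space_def by auto
  obtain b where b: "g = (\<lambda>x. \<Sum>\<alpha>\<in>A. b \<alpha> * monomial \<alpha> x)"
    using assms(2) unfolding poly_space_def by auto
  have "(\<lambda>x. f x + g x) = (\<lambda>x. \<Sum>\<alpha>\<in>A. (a \<alpha> + b \<alpha>) * monomial \<alpha> x)"
    unfolding a b by (simp add: sum.distrib algebra_simps)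
  then show ?thesis unfolding poly_space_def by (auto intro!: exI)
qed

lemma poly_space_scale:
  assumes "f \<in> poly_space A"
  shows "(\<lambda>x. c * f x) \<in> poly_space A"
proof -
  obtain a where a: "f = (\<lambda>x. \<Sum>\<alpha>\<in>A. a \<alpha> * monomial \<alpha> x)"
    using assms(1) unfolding poly_space_def by auto
  have "(\<lambda>x. c * f x) = (\<lambda>x. \<Sum>\<alpha>\<in>A. (c * a \<alpha>) * monomial \<alpha> x)"
    unfolding a by (simp add: sum_distrib_left algebra_simps)
  then show ?thesis unfolding poly_space_def by (auto intro!: exI)
qed

lemma poly_space_diff:
  assumes "f \<in> poly_space A" "g \<in> poly_space A"
  shows "(\<lambda>x. f x - g x) \<in> poly_space A"
  using poly_space_add[OF assms(1) poly_space_scale[OF assms(2), of "-1"]] by simp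

lemma poly_space_sum:
  assumes "\<And>j. j \<in> J \<Longrightarrow> f j \<in> poly_space A"
  shows "(\<lambda>x. \<Sum>j\<in>J. f j x) \<in> poly_space A"
  using assms
  by (induction J rule: infinite_finite_induct) (simp_all add: poly_space_0 poly_space_add)

lemma poly_space_monomial:
  assumes "\<alpha> \<in> A" "finite A"
  shows "monomial \<alpha> \<in> poly_space A"
proof -
  have "monomial \<alpha> = (\<lambda>x. \<Sum>\<beta>\<in>A. (if \<beta> = \<alpha> then 1 else 0) * monomial \<beta> x)"
    using assms by (auto simp: if_distrib[of "\<lambda>c. c * _"] sum.delta cong: if_cong)
  then show ?thesis unfolding poly_space_def by (auto intro!: exI)
qed

lemma monomial_mult: "monomial \<alpha> x * monomial \<beta> x = monomial (\<lambda>i. \<alpha> i + \<beta> i) x"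
  unfolding monomial_def by (simp add: power_add prod.distrib)

lemma poly_space_mult:
  assumes "f \<in> poly_space A" "g \<in> poly_space B" "finite C"
    and C: "\<And>\<alpha> \<beta>. \<alpha> \<in> A \<Longrightarrow> \<beta> \<in> B \<Longrightarrow> (\<lambda>i. \<alpha> i + \<beta> i) \<in> C"
  shows "(\<lambda>x. f x * g x) \<in> poly_space C"
proof -
  obtain a where a: "f = (\<lambda>x. \<Sum>\<alpha>\<in>A. a \<alpha> * monomial \<alpha> x)"
    using assms(1) unfolding poly_space_def by auto
  obtain b where b: "g = (\<lambda>x. \<Sum>\<alpha>\<in>B. b \<alpha> * monomial \<alpha> x)"
    using assms(2) unfolding poly_space_def by auto
  have "(\<lambda>x. f x * g x) =
      (\<lambda>x. \<Sum>\<alpha>\<in>A. \<Sum>\<beta>\<in>B. (a \<alpha> * b \<beta>) * monomial (\<lambda>i. \<alpha> i + \<beta> i) x)"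
    unfolding a b sum_product by (simp add: monomial_mult[symmetric] algebra_simps)
  also have "\<dots> \<in> poly_space C"
    by (intro poly_space_sum poly_space_scale poly_space_monomial C assms(3))
  finally show ?thesis .
qed

lemma degs_mult:
  assumes "f \<in> poly_space (degs k s)" "g \<in> poly_space (degs k' (Suc s'))"
  shows "(\<lambda>x. f x * g x) \<in> poly_space (degs (k + k') (s + s'))"
  by (rule poly_space_mult[OF assms]) (auto simp: sum.distrib)

lemma const_in_polys: "(\<lambda>x. c) \<in> poly_space (degs 0 (Suc n))"
proof -
  have "(\<lambda>x. c * monomial (\<lambda>_. 0) x) \<in> poly_space (degs 0 (Suc n))"
    by (intro poly_space_scale poly_space_monomial) auto
  then show ?thesis by (simp add: monomial_def)
qed

lemma coord_in_degs: "(\<lambda>x. x $ i) \<in> poly_space (degs (Suc 0) (Suc (Suc 0)))"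
proof -
  have "monomial (\<lambda>j. if j = i then 1 else 0) \<in> poly_space (degs (Suc 0) (Suc (Suc 0)))"
    by (intro poly_space_monomial) (auto simp: sum.delta)
  moreover have "monomial (\<lambda>j. if j = i then 1 else 0) = (\<lambda>x. x $ i)"
    by (rule ext) (simp add: monomial_def if_distrib[of "\<lambda>e. _ ^ e"] prod.delta cong: if_cong)
  ultimately show ?thesis by simp
qed

lemma linear_in_degs: "(\<lambda>x. u \<bullet> x) \<in> poly_space (degs (Suc 0) (Suc (Suc 0)))"
  unfolding inner_vec_def inner_real_def
  by (intro poly_space_sum poly_space_scale coord_in_degs)

lemma affine_in_polys: "(\<lambda>x. u \<bullet> x + c) \<in> polys (Suc (Suc 0))"
  by (intro poly_space_add const_in_polys poly_space_mono[OF linear_in_degs])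
     auto

text \<open>Induction principle used for substitution and for division: a degree-indexed property that is multiplicative
  and holds for constants and coordinates passes to all monomials.\<close>

lemma monomial_closed:
  assumes 1: "Q 0 (\<lambda>x. 1)" and i: "\<And>i. Q (Suc 0) (\<lambda>x. x $ i)"
    and mult: "\<And>m n f g. Q m f \<Longrightarrow> Q n g \<Longrightarrow> Q (m + n) (\<lambda>x. f x * g x)"
  shows "Q (sum \<alpha> UNIV) (monomial \<alpha>)"
proof -
  have pow: "Q k (\<lambda>x. (x $ i) ^ k)" for i k
  proof (induction k)
    case (Suc k)
    then show ?case using mult[OF i[of i] Suc] by simp
  qed (simp add: 1)
  have "Q (sum \<alpha> S) (\<lambda>x. \<Prod>i\<in>S. (x $ i) ^ \<alpha> i)" if "finite S" for S
    using that by (induction S) (simp_all add: 1 mult pow)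
  then show ?thesis unfolding monomial_def by simp
qed

lemma polys_compose:
  fixes A :: "real ^ 'e::finite \<Rightarrow> real ^ 'd::finite"
  assumes "f \<in> polys s" and A: "\<And>i. (\<lambda>y. A y $ i) \<in> polys (Suc (Suc 0))"
  shows "(\<lambda>y. f (A y)) \<in> polys s"
proof -
  have mono: "(\<lambda>y. monomial \<alpha> (A y)) \<in> polys (Suc (sum \<alpha> UNIV))" for \<alpha>
    by (rule monomial_closed[of "\<lambda>n f. (\<lambda>y. f (A y)) \<in> polys (Suc n)"])
       (use A in \<open>auto simp: const_in_polys dest: degs_mult\<close>)
  obtain a where a: "f = (\<lambda>x. \<Sum>\<alpha>\<in>degs 0 s. a \<alpha> * monomial \<alpha> x)"
    using assms(1) unfolding poly_space_def by auto
  show ?thesis unfolding a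
    by (intro poly_space_sum poly_space_scale poly_space_mono[OF mono]) auto
qed

lemma polys_translate:
  assumes "f \<in> polys s"
  shows "(\<lambda>y. f (X + y)) \<in> polys s"
proof (rule polys_compose[OF assms])
  fix i
  show "(\<lambda>y. (X + y) $ i) \<in> polys (Suc (Suc 0))"
    using affine_in_polys[of "axis i 1" "X $ i"] by (simp add: inner_axis' add.commute)
qed

text \<open>The factor theorem for a hyperplane. With \<open>proj\<close> a projection onto the hyperplane, \<open>h - h
  \<circ> proj\<close> is divisible by the equation of the hyperplane for coordinates \<open>h\<close>, hence,
  by the product rule for differences, for every polynomial; and \<open>f \<circ> proj = 0\<close> by
  assumption.\<close>

lemma polys_division:
  fixes f :: "real ^ 'd::finite \<Rightarrow> real"
  assumes f: "f \<in> polys (Suc n)" and "u \<noteq> 0"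
    and vanish: "\<And>x. u \<bullet> x = c \<Longrightarrow> f x = 0"
  shows "\<exists>g\<in>polys n. \<forall>x. f x = (u \<bullet> x - c) * g x"
proof -
  define w where "w = (1 / (u \<bullet> u)) *\<^sub>R u"
  define l where "l x = u \<bullet> x - c" for x
  define proj where "proj x = x - l x *\<^sub>R w" for x
  have uw: "u \<bullet> w = 1" using \<open>u \<noteq> 0\<close> by (simp add: w_def)
  have proj: "u \<bullet> proj x = c" for x
    using uw by (simp add: proj_def l_def inner_diff_right)
  define Q where "Q n h \<longleftrightarrow> h \<in> polys (Suc n) \<and> (\<lambda>x. h (proj x)) \<in> polys (Suc n) \<and>
    (\<exists>g\<in>polys n. \<forall>x. h x - h (proj x) = l x * g x)" for n and h :: "real ^ 'd \<Rightarrow> real"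
  have Q_mult: "Q (m + n) (\<lambda>x. f x * g x)" if "Q m f" "Q n g" for m n f g
  proof -
    from that obtain f' g' where *: "f \<in> polys (Suc m)" "(\<lambda>x. f (proj x)) \<in> polys (Suc m)"
      "g \<in> polys (Suc n)" "(\<lambda>x. g (proj x)) \<in> polys (Suc n)" "f' \<in> polys m" "g' \<in> polys n"
      "\<And>x. f x - f (proj x) = l x * f' x" "\<And>x. g x - g (proj x) = l x * g' x"
      unfolding Q_def by blast
    have "f x * g x - f (proj x) * g (proj x) = l x * (f' x * g x + g' x * f (proj x))" for x
      using *(7)[of x] *(8)[of x] by algebra
    moreover have "(\<lambda>x. f' x * g x + g' x * f (proj x)) \<in> polys (m + n)"
      using poly_space_add[OF degs_mult[OF *(5,3)], of "\<lambda>x. g' x * f (proj x)"]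
        degs_mult[OF *(6,2)] by (simp add: add.commute)
    ultimately show ?thesis
      unfolding Q_def using degs_mult[OF *(1,3)] degs_mult[OF *(2,4)] by auto
  qed
  have Q1: "Q 0 (\<lambda>x. 1)"
    unfolding Q_def by (auto simp: const_in_polys intro!: bexI[of _ "\<lambda>_. 0"] poly_space_0)
  have Qi: "Q (Suc 0) (\<lambda>x. x $ i)" for i
  proof -
    have "(\<lambda>x. x $ i) \<in> polys (Suc (Suc 0))"
      by (rule poly_space_mono[OF coord_in_degs]) auto
    moreover have "(\<lambda>x. (proj x) $ i) \<in> polys (Suc (Suc 0))"
      using affine_in_polys[of "axis i 1 - (w $ i) *\<^sub>R u" "c * w $ i"]
      by (simp add: proj_def l_def inner_diff_left inner_axis' algebra_simps)
    moreover have "x $ i - (proj x) $ i = l x * w $ i" for x by (simp add: proj_def)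
    ultimately show ?thesis
      unfolding Q_def by (auto intro!: bexI[of _ "\<lambda>_. w $ i"] const_in_polys)
  qed
  obtain a where a: "f = (\<lambda>x. \<Sum>\<alpha>\<in>degs 0 (Suc n). a \<alpha> * monomial \<alpha> x)"
    using f unfolding poly_space_def by auto
  have "\<forall>\<alpha>. \<exists>g\<in>polys (sum \<alpha> UNIV). \<forall>x. monomial \<alpha> x - monomial \<alpha> (proj x) = l x * g x"
    using monomial_closed[of Q, OF Q1 Qi Q_mult] unfolding Q_def by blast
  then obtain G where G: "\<And>\<alpha>. G \<alpha> \<in> polys (sum \<alpha> UNIV)"
    "\<And>\<alpha> x. monomial \<alpha> x - monomial \<alpha> (proj x) = l x * G \<alpha> x" by metis
  have "f x = l x * (\<Sum>\<alpha>\<in>degs 0 (Suc n). a \<alpha> * G \<alpha> x)" for x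
  proof -
    have "f x = f x - f (proj x)" using vanish[OF proj] by simp
    also have "\<dots> = (\<Sum>\<alpha>\<in>degs 0 (Suc n). a \<alpha> * (monomial \<alpha> x - monomial \<alpha> (proj x)))"
      unfolding a by (simp add: sum_subtractf algebra_simps)
    finally show ?thesis unfolding G(2) by (simp add: sum_distrib_left mult_ac)
  qed
  moreover have "(\<lambda>x. \<Sum>\<alpha>\<in>degs 0 (Suc n). a \<alpha> * G \<alpha> x) \<in> polys n"
    by (intro poly_space_sum poly_space_scale poly_space_mono[OF G(1)]) auto
  ultimately show ?thesis unfolding l_def by (intro bexI[of _ "\<lambda>x. \<Sum>\<alpha>\<in>degs 0 (Suc n). a \<alpha> * G \<alpha> x"]) auto
qed

section \<open>Mixed derivatives and Taylor expansion of polynomials\<close>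

lemma partial_deriv_translate:
  "partial_deriv i (\<lambda>y. f (X + y)) = (\<lambda>y. partial_deriv i f (X + y))"
  unfolding partial_deriv_def by (simp add: add.assoc)

lemma mixed_deriv_translate:
  "mixed_deriv \<alpha> (\<lambda>y. f (X + y)) = (\<lambda>y. mixed_deriv \<alpha> f (X + y))"
proof -
  have pow: "(partial_deriv i ^^ k) (\<lambda>y. g (X + y)) = (\<lambda>y. (partial_deriv i ^^ k) g (X + y))"
    for i k g
    by (induction k) (simp_all add: partial_deriv_translate)
  have "foldr (\<lambda>i g. (partial_deriv i ^^ \<alpha> i) g) xs (\<lambda>y. f (X + y)) =
      (\<lambda>y. foldr (\<lambda>i g. (partial_deriv i ^^ \<alpha> i) g) xs f (X + y))" for xs
    by (induction xs) (simp_all add: pow)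
  then show ?thesis unfolding mixed_deriv_def .
qed

text \<open>The \<open>k\<close>-th derivative of \<open>t ^ a\<close>; the binomial coefficient makes it vanish for
  \<open>k > a\<close>.\<close>

definition deriv_power :: "nat \<Rightarrow> nat \<Rightarrow> real \<Rightarrow> real" where
  "deriv_power k a t = fact k * real (a choose k) * t ^ (a - k)"

lemma deriv_power_0 [simp]: "deriv_power 0 a t = t ^ a"
  by (simp add: deriv_power_def)

lemma deriv_power_at_0: "deriv_power k a 0 = (if a = k then fact k else 0)"
  by (auto simp: deriv_power_def power_0_left)

lemma has_derivative_deriv_power:
  "(deriv_power k a has_real_derivative deriv_power (Suc k) a t) (at t)"
proof -
  have "(a - k) * (a choose k) = Suc k * (a choose Suc k)"
    by (metis binomial_absorb_comp binomial_absorption mult.commute)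
  then have "real (a - k) * real (a choose k) = real (Suc k) * real (a choose Suc k)"
    by (metis of_nat_mult)
  then have "fact k * (real (a - k) * real (a choose k)) * t ^ (a - k - 1) =
      fact k * (real (Suc k) * real (a choose Suc k)) * t ^ (a - k - 1)"
    by simp
  then have "fact k * real (a choose k) * (real (a - k) * t ^ (a - k - 1)) =
      deriv_power (Suc k) a t"
    unfolding deriv_power_def by (simp only: fact_Suc mult_ac) simp
  moreover have "(deriv_power k a has_real_derivative
      fact k * real (a choose k) * (real (a - k) * t ^ (a - k - 1))) (at t)"
    unfolding deriv_power_def by (auto intro!: derivative_eq_intros)
  ultimately show ?thesis by simp
qed

lemma partial_deriv_sum_deriv_power:
  fixes A :: "('d::finite \<Rightarrow> nat) set"
  shows "partial_deriv i (\<lambda>x. \<Sum>\<alpha>\<in>A. a \<alpha> * (\<Prod>j\<in>UNIV. deriv_power (k j) (\<alpha> j) (x $ j))) =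
    (\<lambda>x. \<Sum>\<alpha>\<in>A. a \<alpha> * (\<Prod>j\<in>UNIV. deriv_power ((k(i := Suc (k i))) j) (\<alpha> j) (x $ j)))"
proof (rule ext)
  fix x :: "real ^ 'd"
  define P where "P \<alpha> = (\<Prod>j\<in>UNIV - {i}. deriv_power (k j) (\<alpha> j) (x $ j))" for \<alpha> :: "'d \<Rightarrow> nat"
  have split: "(\<Prod>j\<in>UNIV. deriv_power (k j) (\<alpha> j) ((x + t *\<^sub>R axis i 1) $ j)) =
      deriv_power (k i) (\<alpha> i) (x $ i + t) * P \<alpha>" for \<alpha> t
    by (subst prod.remove[of _ i]) (auto simp: P_def axis_def intro!: prod.cong)
  have split': "(\<Prod>j\<in>UNIV. deriv_power ((k(i := Suc (k i))) j) (\<alpha> j) (x $ j)) =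
      deriv_power (Suc (k i)) (\<alpha> i) (x $ i) * P \<alpha>" for \<alpha>
    by (subst prod.remove[of _ i]) (auto simp: P_def intro!: prod.cong)
  have "((\<lambda>t. deriv_power (k i) (\<alpha> i) (x $ i + t)) has_real_derivative
      deriv_power (Suc (k i)) (\<alpha> i) (x $ i)) (at 0)" for \<alpha>
    using has_derivative_deriv_power[of "k i" "\<alpha> i" "x $ i"]
      DERIV_shift[of "deriv_power (k i) (\<alpha> i)" _ 0 "x $ i"]
    by (simp add: add.commute[of "x $ i"])
  then have "((\<lambda>t. \<Sum>\<alpha>\<in>A. a \<alpha> * (deriv_power (k i) (\<alpha> i) (x $ i + t) * P \<alpha>)) has_real_derivative
      (\<Sum>\<alpha>\<in>A. a \<alpha> * (deriv_power (Suc (k i)) (\<alpha> i) (x $ i) * P \<alpha>))) (at 0)"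
    by (intro DERIV_sum DERIV_cmult DERIV_cmult_right)
  then show "partial_deriv i (\<lambda>x. \<Sum>\<alpha>\<in>A. a \<alpha> * (\<Prod>j\<in>UNIV. deriv_power (k j) (\<alpha> j) (x $ j))) x =
      (\<Sum>\<alpha>\<in>A. a \<alpha> * (\<Prod>j\<in>UNIV. deriv_power ((k(i := Suc (k i))) j) (\<alpha> j) (x $ j)))"
    unfolding partial_deriv_def split split' by (rule DERIV_imp_deriv)
qed

lemma distinct_coord_list: "distinct (coord_list :: 'd::finite list)"
  and set_coord_list: "set (coord_list :: 'd::finite list) = UNIV"
proof -
  have "\<exists>is :: 'd list. distinct is \<and> set is = UNIV"
    using finite_distinct_list[of "UNIV :: 'd set"] by auto
  from someI_ex[OF this] show "distinct (coord_list :: 'd list)" "set (coord_list :: 'd list) = UNIV"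
    unfolding coord_list_def by auto
qed

text \<open>The differentiations act on one coordinate of each monomial at a time, so after any part of the coordinate
  list has been processed the result is the sum of products of the corresponding one-dimensional derivatives.\<close>

lemma mixed_deriv_polynomial:
  fixes A :: "('d::finite \<Rightarrow> nat) set"
  shows "mixed_deriv \<beta> (\<lambda>x. \<Sum>\<alpha>\<in>A. a \<alpha> * monomial \<alpha> x) =
    (\<lambda>x. \<Sum>\<alpha>\<in>A. a \<alpha> * (\<Prod>j\<in>UNIV. deriv_power (\<beta> j) (\<alpha> j) (x $ j)))"
proof -
  define D where "D k = (\<lambda>x :: real ^ 'd.
    \<Sum>\<alpha>\<in>A. a \<alpha> * (\<Prod>j\<in>UNIV. deriv_power (k j) (\<alpha> j) (x $ j)))" for k
  have pow: "(partial_deriv i ^^ n) (D k) = D (k(i := k i + n))" for i n k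
  proof (induction n)
    case (Suc n)
    have "(partial_deriv i ^^ Suc n) (D k) = partial_deriv i (D (k(i := k i + n)))"
      by (simp only: funpow.simps comp_def Suc)
    also have "\<dots> = D ((k(i := k i + n))(i := Suc ((k(i := k i + n)) i)))"
      unfolding D_def by (rule partial_deriv_sum_deriv_power)
    also have "(k(i := k i + n))(i := Suc ((k(i := k i + n)) i)) = k(i := k i + Suc n)"
      by auto
    finally show ?case .
  qed simp
  have "foldr (\<lambda>i g. (partial_deriv i ^^ \<beta> i) g) xs (D (\<lambda>_. 0)) =
      D (\<lambda>j. if j \<in> set xs then \<beta> j else 0)" if "distinct xs" for xs
    using that
  proof (induction xs)
    case (Cons i xs)
    have "(\<lambda>j. if j \<in> set xs then \<beta> j else 0)(i := 0 + \<beta> i) =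
        (\<lambda>j. if j \<in> set (i # xs) then \<beta> j else 0)"
      by auto
    with Cons show ?case by (simp add: pow fun_upd_def)
  qed simp
  from this[OF distinct_coord_list] have "mixed_deriv \<beta> (D (\<lambda>_. 0)) = D \<beta>"
    unfolding mixed_deriv_def set_coord_list by simp
  then show ?thesis by (simp add: D_def monomial_def)
qed

lemma prod_deriv_power_at_0:
  fixes \<alpha> \<beta> :: "'d::finite \<Rightarrow> nat"
  shows "(\<Prod>j\<in>UNIV. deriv_power (\<beta> j) (\<alpha> j) 0) =
    (if \<alpha> = \<beta> then (\<Prod>j\<in>UNIV. fact (\<beta> j)) else (0::real))"
proof (cases "\<alpha> = \<beta>")
  case False
  then have "\<exists>j. \<alpha> j \<noteq> \<beta> j" by auto
  with False show ?thesis by (simp add: deriv_power_at_0)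
qed (simp add: deriv_power_at_0)

text \<open>Derivatives at \<open>X\<close> and coefficients of the expansion at \<open>X\<close> determine each other:
  after translation to the origin, only the monomial with exponent \<open>\<beta>\<close> survives
  differentiation by \<open>\<beta>\<close> and evaluation.\<close>

lemma mixed_deriv_taylor:
  assumes "finite A" "\<And>y. f (X + y) = (\<Sum>\<alpha>\<in>A. b \<alpha> * monomial \<alpha> y)"
  shows "mixed_deriv \<beta> f X = (if \<beta> \<in> A then b \<beta> * (\<Prod>j\<in>UNIV. fact (\<beta> j)) else 0)"
proof -
  have "mixed_deriv \<beta> f X = mixed_deriv \<beta> (\<lambda>y. f (X + y)) 0"
    by (simp add: mixed_deriv_translate)
  also have "\<dots> = (\<Sum>\<alpha>\<in>A. b \<alpha> * (\<Prod>j\<in>UNIV. deriv_power (\<beta> j) (\<alpha> j) 0))"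
    by (simp add: assms(2) mixed_deriv_polynomial)
  also have "\<dots> = (\<Sum>\<alpha>\<in>A. if \<alpha> = \<beta> then b \<beta> * (\<Prod>j\<in>UNIV. fact (\<beta> j)) else 0)"
    unfolding prod_deriv_power_at_0 by (intro sum.cong) auto
  finally show ?thesis using assms(1) by simp
qed

lemma taylor_expansion:
  assumes "f \<in> polys s"
  obtains b where "\<And>y. f (X + y) = (\<Sum>\<alpha>\<in>degs 0 s. b \<alpha> * monomial \<alpha> y)"
    "\<And>\<beta>. sum \<beta> UNIV < s \<Longrightarrow> mixed_deriv \<beta> f X = b \<beta> * (\<Prod>j\<in>UNIV. fact (\<beta> j))"
proof -
  obtain b where b: "(\<lambda>y. f (X + y)) = (\<lambda>y. \<Sum>\<alpha>\<in>degs 0 s. b \<alpha> * monomial \<alpha> y)"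
    using polys_translate[OF assms, of X] unfolding poly_space_def by auto
  then have b': "f (X + y) = (\<Sum>\<alpha>\<in>degs 0 s. b \<alpha> * monomial \<alpha> y)" for y by meson
  show thesis
    using mixed_deriv_taylor[OF _ b'] by (intro that[OF b']) auto
qed

section \<open>Order of vanishing at a point\<close>

text \<open>The order is measured on all lines through \<open>X\<close>. This form restricts to subspaces and transforms
  under affine maps without any computation with coefficients.\<close>

definition vanishes_to_order :: "nat \<Rightarrow> (real ^ 'd::finite \<Rightarrow> real) \<Rightarrow> real ^ 'd \<Rightarrow> bool" where
  "vanishes_to_order N f X \<longleftrightarrow> (\<forall>v. \<exists>H. \<forall>t. f (X + t *\<^sub>R v) = t ^ N * poly H t)"

lemma monomial_scaleR: "monomial \<alpha> (t *\<^sub>R v) = t ^ sum \<alpha> UNIV * monomial \<alpha> v"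
  unfolding monomial_def by (simp add: power_mult_distrib prod.distrib power_sum)

lemma continuous_monomial: "continuous_on UNIV (monomial \<alpha>)"
  unfolding monomial_def by (intro continuous_intros)

text \<open>The restriction to the line \<open>t *\<^sub>R v\<close> of the polynomial with coefficients \<open>b\<close>;
  its coefficients, as functions of \<open>v\<close>, are the homogeneous components of that polynomial.\<close>

definition line_poly :: "nat \<Rightarrow> (('d::finite \<Rightarrow> nat) \<Rightarrow> real) \<Rightarrow> real ^ 'd \<Rightarrow> real poly" where
  "line_poly s b v = (\<Sum>\<alpha>\<in>degs 0 s. Polynomial.monom (b \<alpha> * monomial \<alpha> v) (sum \<alpha> UNIV))"

lemma poly_line_poly:
  "poly (line_poly s b v) t = (\<Sum>\<alpha>\<in>degs 0 s. b \<alpha> * monomial \<alpha> (t *\<^sub>R v))"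
  unfolding line_poly_def by (simp add: poly_sum poly_monom monomial_scaleR mult_ac)

lemma coeff_line_poly:
  "coeff (line_poly s b v) k =
    (\<Sum>\<alpha>\<in>degs 0 s. if sum \<alpha> UNIV = k then b \<alpha> * monomial \<alpha> v else 0)"
  unfolding line_poly_def coeff_sum coeff_monom by simp

lemma restrict_to_line:
  fixes f :: "real ^ 'd::finite \<Rightarrow> real"
  assumes "f \<in> polys s"
  obtains Q :: "real ^ 'd \<Rightarrow> real poly"
  where "\<And>v t. f (X + t *\<^sub>R v) = poly (Q v) t" "\<And>v k. s \<le> k \<Longrightarrow> coeff (Q v) k = 0"
    "\<And>k. continuous_on UNIV (\<lambda>v. coeff (Q v) k)"
proof -
  obtain b where b: "\<And>y. f (X + y) = (\<Sum>\<alpha>\<in>degs 0 s. b \<alpha> * monomial \<alpha> y)"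
    using taylor_expansion[OF assms, of X] by metis
  show thesis
  proof (rule that[of "line_poly s b"])
    show "f (X + t *\<^sub>R v) = poly (line_poly s b v) t" for t v
      by (simp add: b poly_line_poly)
    show "coeff (line_poly s b v) k = 0" if "s \<le> k" for v k
      unfolding coeff_line_poly using that by (intro sum.neutral) auto
    show "continuous_on UNIV (\<lambda>v. coeff (line_poly s b v) k)" for k
      unfolding coeff_line_poly
    proof (intro continuous_on_sum)
      fix \<alpha> :: "'d \<Rightarrow> nat"
      show "continuous_on UNIV (\<lambda>v. if sum \<alpha> UNIV = k then b \<alpha> * monomial \<alpha> v else 0)"
        by (cases "sum \<alpha> UNIV = k") (simp_all add: continuous_on_mult continuous_monomial)
    qed
  qed
qed

lemma power_factor_iff_coeff_0:
  fixes q :: "real poly"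
  shows "(\<exists>H. \<forall>t. poly q t = t ^ N * poly H t) \<longleftrightarrow> (\<forall>k<N. coeff q k = 0)"
proof -
  have "(\<exists>H. \<forall>t. poly q t = t ^ N * poly H t) \<longleftrightarrow> (\<exists>H. q = Polynomial.monom 1 N * H)"
    by (simp add: poly_eq_poly_eq_iff[symmetric] fun_eq_iff poly_monom)
  also have "\<dots> \<longleftrightarrow> (\<forall>k<N. coeff q k = 0)"
    unfolding monom_1_dvd_iff'[symmetric] dvd_def ..
  finally show ?thesis .
qed

lemma vanishes_to_order_iff_coeff:
  assumes "\<And>v t. f (X + t *\<^sub>R v) = poly (Q v) t"
  shows "vanishes_to_order N f X \<longleftrightarrow> (\<forall>v. \<forall>k<N. coeff (Q v) k = 0)"
  unfolding vanishes_to_order_def assms power_factor_iff_coeff_0 ..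

lemma vanishes_to_order_if_derivs_0:
  fixes f :: "real ^ 'd::finite \<Rightarrow> real"
  assumes f: "f \<in> polys s"
    and derivs: "\<And>\<alpha>. \<alpha> \<in> multi_indices p \<Longrightarrow> mixed_deriv \<alpha> f X = 0"
  shows "vanishes_to_order (Suc p) f X"
proof -
  obtain b where b: "\<And>y. f (X + y) = (\<Sum>\<alpha>\<in>degs 0 s. b \<alpha> * monomial \<alpha> y)"
    "\<And>\<beta>. sum \<beta> UNIV < s \<Longrightarrow> mixed_deriv \<beta> f X = b \<beta> * (\<Prod>j\<in>UNIV. fact (\<beta> j))"
    using taylor_expansion[OF f, of X] by metis
  have b0: "b \<beta> = 0" if "sum \<beta> UNIV < s" "sum \<beta> UNIV < Suc p" for \<beta>
    using derivs[of \<beta>] b(2)[of \<beta>] that by (simp add: multi_indices_def)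
  have line: "f (X + t *\<^sub>R v) = poly (line_poly s b v) t" for t v
    by (simp add: b(1) poly_line_poly)
  have "coeff (line_poly s b v) k = 0" if "k < Suc p" for v k
    unfolding coeff_line_poly using that b0 by (intro sum.neutral) auto
  then show ?thesis unfolding vanishes_to_order_iff_coeff[of f, OF line] by blast
qed

lemma vanishes_to_order_mono:
  assumes "vanishes_to_order N f X" "M \<le> N"
  shows "vanishes_to_order M f X"
  unfolding vanishes_to_order_def
proof
  fix v
  obtain H where H: "\<And>t. f (X + t *\<^sub>R v) = t ^ N * poly H t"
    using assms(1) unfolding vanishes_to_order_def by metis
  have "t ^ N * poly H t = t ^ M * poly (Polynomial.monom 1 (N - M) * H) t" for t
    using assms(2) by (simp add: poly_monom power_add[symmetric])
  with H show "\<exists>H. \<forall>t. f (X + t *\<^sub>R v) = t ^ M * poly H t" by metis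
qed

lemma vanishes_to_order_1:
  assumes "f \<in> polys s" "f X = 0"
  shows "vanishes_to_order (Suc 0) f X"
proof -
  obtain Q where Q: "\<And>v t. f (X + t *\<^sub>R v) = poly (Q v) t"
    using restrict_to_line[OF assms(1), of X] by metis
  have "coeff (Q v) 0 = 0" for v
    using Q[of 0 v] assms(2) by (simp add: poly_0_coeff_0)
  then show ?thesis unfolding vanishes_to_order_iff_coeff[of f, OF Q] by simp
qed

lemma vanishes_to_order_compose:
  assumes "vanishes_to_order N f (A y)" "\<And>t v. A (y + t *\<^sub>R v) = A y + t *\<^sub>R L v"
  shows "vanishes_to_order N (\<lambda>y. f (A y)) y"
  using assms(1) unfolding vanishes_to_order_def assms(2) by blast

lemma zero_if_vanishes_beyond_degree:
  assumes "f \<in> polys s" "vanishes_to_order s f X"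
  shows "f x = 0"
proof -
  obtain Q where Q: "\<And>v t. f (X + t *\<^sub>R v) = poly (Q v) t" "\<And>v k. s \<le> k \<Longrightarrow> coeff (Q v) k = 0"
    using restrict_to_line[OF assms(1), of X] by metis
  have "Q v = 0" for v
    using assms(2) Q(2)[of _ v] unfolding vanishes_to_order_iff_coeff[of f, OF Q(1)]
    by (intro poly_eqI) (metis coeff_0 not_less)
  then show ?thesis using Q(1)[of 1 "x - X"] by simp
qed

text \<open>The factors \<open>x ^ m\<close> and \<open>(x - 1) ^ n\<close> are coprime, so together they force degree at
  least \<open>m + n\<close>.\<close>

lemma poly_zero_if_roots_0_1:
  fixes q :: "real poly"
  assumes deg: "\<And>k. m + n \<le> k \<Longrightarrow> coeff q k = 0"
    and 0: "\<And>t. poly q t = t ^ m * poly F t"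
    and 1: "\<And>t. poly q (1 + t) = t ^ n * poly G t"
  shows "q = 0"
proof (rule ccontr)
  assume "q \<noteq> 0"
  have F: "q = [:0, 1:] ^ m * F"
    by (simp add: poly_eq_poly_eq_iff[symmetric] fun_eq_iff 0)
  have "poly q t = poly ([:-1, 1:] ^ n * (G \<circ>\<^sub>p [:-1, 1:])) t" for t
    using 1[of "t - 1"] by (simp add: poly_pcompose)
  then have G: "q = [:-1, 1:] ^ n * (G \<circ>\<^sub>p [:-1, 1:])"
    by (simp add: poly_eq_poly_eq_iff[symmetric] fun_eq_iff)
  have nz: "F \<noteq> 0" using F \<open>q \<noteq> 0\<close> by auto
  have "order 1 q = order 1 ([:0, 1:] ^ m :: real poly) + order 1 F"
    using \<open>q \<noteq> 0\<close> unfolding F by (rule order_mult)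
  also have "order 1 ([:0, 1:] ^ m :: real poly) = 0" by (rule order_0I) simp
  finally have "order 1 q \<le> degree F" using order_degree[OF nz, of 1] by simp
  moreover have "n \<le> order 1 q"
    using G \<open>q \<noteq> 0\<close> by (metis dvd_triv_left order_divides)
  moreover have "degree q = m + degree F"
    using nz unfolding F by (subst degree_mult_eq) (auto simp: degree_power_eq)
  ultimately have "coeff q (degree q) = 0" using deg[of "degree q"] by simp
  with \<open>q \<noteq> 0\<close> show False by simp
qed

lemma vanishes_on_line:
  assumes f: "f \<in> polys s" and "s \<le> M + N"
    and a: "vanishes_to_order M f a" and b: "vanishes_to_order N f b"
  shows "f (a + t *\<^sub>R (b - a)) = 0"
proof -
  obtain Q where Q: "\<And>v t. f (a + t *\<^sub>R v) = poly (Q v) t" "\<And>v k. s \<le> k \<Longrightarrow> coeff (Q v) k = 0"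
    using restrict_to_line[OF f, of a] by metis
  obtain F where F: "\<And>t. f (a + t *\<^sub>R (b - a)) = t ^ M * poly F t"
    using a unfolding vanishes_to_order_def by metis
  obtain G where G: "\<And>t. f (b + t *\<^sub>R (b - a)) = t ^ N * poly G t"
    using b unfolding vanishes_to_order_def by metis
  have "Q (b - a) = 0"
  proof (rule poly_zero_if_roots_0_1[of M N _ F G])
    show "coeff (Q (b - a)) k = 0" if "M + N \<le> k" for k
      using Q(2) that \<open>s \<le> M + N\<close> by simp
    show "poly (Q (b - a)) t = t ^ M * poly F t" for t using Q(1) F by metis
    have "a + (1 + t) *\<^sub>R (b - a) = b + t *\<^sub>R (b - a)" for t by (simp add: algebra_simps)
    then show "poly (Q (b - a)) (1 + t) = t ^ N * poly G t" for t
      using Q(1)[of "1 + t" "b - a"] G by metis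
  qed
  then show ?thesis using Q(1) by simp
qed

text \<open>On a line transversal to the hyperplane, the linear factor contributes at most one to the order of
  \<open>f\<close>, and nothing at a point off the hyperplane. Lines inside the hyperplane carry no information
  about \<open>g\<close> directly; they are limits of transversal lines, and the coefficients depend
  continuously on the direction.\<close>

lemma vanishes_to_order_cofactor:
  fixes f g :: "real ^ 'd::finite \<Rightarrow> real"
  assumes g: "g \<in> polys s" and fg: "\<And>x. f x = (u \<bullet> x - c) * g x"
    and f: "vanishes_to_order N f X" and "u \<noteq> 0"
  shows "u \<bullet> X \<noteq> c \<Longrightarrow> vanishes_to_order N g X"
    and "vanishes_to_order (N - 1) g X"
proof -
  obtain Q where Q: "\<And>v t. g (X + t *\<^sub>R v) = poly (Q v) t"
    and cont: "\<And>k. continuous_on UNIV (\<lambda>v. coeff (Q v) k)"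
    using restrict_to_line[OF g, of X] by metis
  have line: "f (X + t *\<^sub>R v) = poly ([:u \<bullet> X - c, u \<bullet> v:] * Q v) t" for t v
    by (simp add: fg Q inner_add_right algebra_simps)
  have coeff0: "coeff ([:u \<bullet> X - c, u \<bullet> v:] * Q v) k = 0" if "k < N" for v k
    using f that unfolding vanishes_to_order_iff_coeff[of f, OF line] by blast
  {
    assume "u \<bullet> X \<noteq> c"
    have "coeff (Q v) k = 0" if "k < N" for v k
      using that
    proof (induction k)
      case 0
      then show ?case using coeff0[of 0 v] \<open>u \<bullet> X \<noteq> c\<close> by simp
    next
      case (Suc k)
      then show ?case using coeff0[of "Suc k" v] \<open>u \<bullet> X \<noteq> c\<close> by simp
    qed
    then show "vanishes_to_order N g X"
      unfolding vanishes_to_order_iff_coeff[of g, OF Q] by blast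
  }
  note off = this
  show "vanishes_to_order (N - 1) g X"
  proof (cases "u \<bullet> X = c")
    case False
    then show ?thesis using off vanishes_to_order_mono by fastforce
  next
    case True
    have ne: "coeff (Q v) k = 0" if "k < N - 1" "u \<bullet> v \<noteq> 0" for v k
      using coeff0[of "Suc k" v] that True by simp
    have "coeff (Q v) k = 0" if "k < N - 1" for v k
    proof (cases "u \<bullet> v = 0")
      case True
      \<comment> \<open>approach \<open>v\<close> along directions transversal to the hyperplane\<close>
      have "isCont (\<lambda>v. coeff (Q v) k) v"
        using cont[of k] by (simp add: continuous_on_eq_continuous_at)
      then have "((\<lambda>r. coeff (Q (v + r *\<^sub>R u)) k) \<longlongrightarrow> coeff (Q v) k) (at 0)"
        by (rule isCont_tendsto_compose) (auto intro!: tendsto_eq_intros)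
      moreover have "eventually (\<lambda>r. coeff (Q (v + r *\<^sub>R u)) k = 0) (at 0)"
        using True ne[OF that] \<open>u \<noteq> 0\<close>
        by (auto simp: eventually_at_filter inner_add_right intro!: always_eventually)
      ultimately have "((\<lambda>r. 0) \<longlongrightarrow> coeff (Q v) k) (at (0::real))"
        using tendsto_cong by fastforce
      then show ?thesis by (simp add: tendsto_const_iff)
    qed (use that ne in auto)
    then show ?thesis unfolding vanishes_to_order_iff_coeff[of g, OF Q] by blast
  qed
qed

section \<open>Regularity as triviality of the kernel\<close>

text \<open>Gaussian elimination of one equation at a time.\<close>

lemma underdetermined_homogeneous_system:
  fixes M :: "'b \<Rightarrow> 'a \<Rightarrow> real"
  assumes "finite B" "finite A" "card B < card A"
  shows "\<exists>x. (\<exists>a\<in>A. x a \<noteq> 0) \<and> (\<forall>b\<in>B. (\<Sum>a\<in>A. M b a * x a) = 0)"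
  using assms
proof (induction B arbitrary: A M rule: finite_induct)
  case empty
  then obtain a where "a \<in> A" by fastforce
  then show ?case by (intro exI[of _ "\<lambda>_. 1"]) auto
next
  case (insert b B)
  show ?case
  proof (cases "\<forall>a\<in>A. M b a = 0")
    case True
    obtain x where "\<exists>a\<in>A. x a \<noteq> 0" "\<forall>b\<in>B. (\<Sum>a\<in>A. M b a * x a) = 0"
      using insert.IH[of A M] insert.prems insert.hyps by auto
    with True show ?thesis by (intro exI[of _ x]) auto
  next
    case False
    then obtain a0 where a0: "a0 \<in> A" "M b a0 \<noteq> 0" by auto
    define A' where "A' = A - {a0}"
    define M' where "M' b' a = M b' a - M b' a0 * M b a / M b a0" for b' a
    have "card B < card A'"
      using insert.prems insert.hyps a0 by (simp add: A'_def)
    then obtain x where x: "\<exists>a\<in>A'. x a \<noteq> 0" "\<forall>b\<in>B. (\<Sum>a\<in>A'. M' b a * x a) = 0"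
      using insert.IH[of A' M'] insert.prems by (auto simp: A'_def)
    define y where "y = x(a0 := - (\<Sum>a\<in>A'. M b a * x a) / M b a0)"
    have split: "(\<Sum>a\<in>A. M b' a * y a) = M b' a0 * y a0 + (\<Sum>a\<in>A'. M b' a * x a)" for b'
    proof -
      have "(\<Sum>a\<in>A'. M b' a * y a) = (\<Sum>a\<in>A'. M b' a * x a)"
        by (rule sum.cong) (auto simp: y_def A'_def)
      then show ?thesis
        using sum.remove[OF _ a0(1), of "\<lambda>a. M b' a * y a"] insert.prems by (simp add: A'_def)
    qed
    have "(\<Sum>a\<in>A. M b a * y a) = 0"
      unfolding split using a0 by (simp add: y_def)
    moreover have "(\<Sum>a\<in>A. M b' a * y a) = 0" if "b' \<in> B" for b'
    proof -
      have "(\<Sum>a\<in>A'. M' b' a * x a) =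
          (\<Sum>a\<in>A'. M b' a * x a) - M b' a0 / M b a0 * (\<Sum>a\<in>A'. M b a * x a)"
        unfolding M'_def by (simp add: sum_distrib_left sum_subtractf[symmetric] algebra_simps)
      with x(2) that show ?thesis
        unfolding split by (simp add: y_def)
    qed
    moreover have "\<exists>a\<in>A. y a \<noteq> 0"
      using x(1) by (auto simp: y_def A'_def)
    ultimately show ?thesis by (intro exI[of _ y]) auto
  qed
qed

lemma square_system_solvable:
  fixes M :: "'b \<Rightarrow> 'a \<Rightarrow> real"
  assumes "finite B" "finite A" "card B = card A"
    and ker: "\<And>x. \<forall>b\<in>B. (\<Sum>a\<in>A. M b a * x a) = 0 \<Longrightarrow> \<forall>a\<in>A. x a = 0"
  shows "\<exists>x. \<forall>b\<in>B. (\<Sum>a\<in>A. M b a * x a) = c b"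
proof -
  \<comment> \<open>the right-hand side becomes a column of its own, with unknown \<open>None\<close>\<close>
  define M' where "M' b = case_option (- c b) (M b)" for b
  define A' where "A' = insert None (Some ` A)"
  have "card B < card A'"
    using assms(2,3) by (simp add: A'_def card_image)
  then obtain x where x: "\<exists>a\<in>A'. x a \<noteq> 0" "\<forall>b\<in>B. (\<Sum>a\<in>A'. M' b a * x a) = 0"
    using underdetermined_homogeneous_system[of B A' M'] assms(1,2) by (auto simp: A'_def)
  have sum: "(\<Sum>a\<in>A'. M' b a * x a) = - c b * x None + (\<Sum>a\<in>A. M b a * x (Some a))" for b
    using assms(2) by (simp add: A'_def M'_def sum.reindex)
  have "x None \<noteq> 0"
  proof
    assume "x None = 0"
    then have "\<forall>a\<in>A. x (Some a) = 0" using ker[of "\<lambda>a. x (Some a)"] x(2) sum by simp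
    with x(1) \<open>x None = 0\<close> show False by (auto simp: A'_def)
  qed
  have "(\<Sum>a\<in>A. M b a * (x (Some a) / x None)) = c b" if "b \<in> B" for b
  proof -
    have "(\<Sum>a\<in>A. M b a * x (Some a)) = c b * x None" using sum[of b] x(2) that by simp
    then have "(\<Sum>a\<in>A. M b a * x (Some a)) / x None = c b" using \<open>x None \<noteq> 0\<close> by simp
    then show ?thesis by (simp add: sum_divide_distrib)
  qed
  then show ?thesis by (intro exI[of _ "\<lambda>a. x (Some a) / x None"]) auto
qed

text \<open>Adding the slack \<open>n - \<Sum> \<alpha>\<close> as a further entry turns multi-indices of degree at most
  \<open>n\<close> into compositions of \<open>n\<close> with \<open>d + 1\<close> parts.\<close>

lemma card_multi_indices:
  "card (multi_indices n :: ('d::finite \<Rightarrow> nat) set) = (n + CARD('d)) choose CARD('d)"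
proof -
  obtain xs :: "'d list" where xs: "distinct xs" "set xs = UNIV"
    using finite_distinct_list[of "UNIV :: 'd set"] by auto
  have len: "length xs = CARD('d)" using distinct_card[OF xs(1)] xs(2) by simp
  have sum: "sum_list (map \<alpha> xs) = sum \<alpha> UNIV" for \<alpha> :: "'d \<Rightarrow> nat"
    using sum_list_distinct_conv_sum_set[OF xs(1), of \<alpha>] xs(2) by simp
  define L where "L = {l :: nat list. length l = CARD('d) + 1 \<and> sum_list l = n}"
  define F where "F \<alpha> = (n - sum \<alpha> UNIV) # map \<alpha> xs" for \<alpha> :: "'d \<Rightarrow> nat"
  have "bij_betw F (multi_indices n) L"
  proof (rule bij_betwI')
    fix \<alpha> \<beta> :: "'d \<Rightarrow> nat"
    show "F \<alpha> = F \<beta> \<longleftrightarrow> \<alpha> = \<beta>" using xs(2) by (auto simp: F_def)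
  next
    fix \<alpha> :: "'d \<Rightarrow> nat"
    assume "\<alpha> \<in> multi_indices n"
    then show "F \<alpha> \<in> L" by (simp add: F_def L_def len sum multi_indices_def)
  next
    fix l assume l: "l \<in> L"
    then obtain k l' where kl: "l = k # l'" "length l' = length xs" "k + sum_list l' = n"
      by (cases l) (auto simp: L_def len)
    define \<alpha> where "\<alpha> i = the (map_of (zip xs l') i)" for i
    have \<alpha>: "map \<alpha> xs = l'"
      using kl(2) xs(1) by (intro nth_equalityI) (auto simp: \<alpha>_def map_of_zip_nth)
    then have "F \<alpha> = l" "\<alpha> \<in> multi_indices n"
      using kl sum[of \<alpha>] by (auto simp: F_def multi_indices_def)
    then show "\<exists>\<alpha>\<in>multi_indices n. l = F \<alpha>" by auto
  qed
  then have "card (multi_indices n :: ('d \<Rightarrow> nat) set) = card L" by (rule bij_betw_same_card)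
  also have "\<dots> = (n + CARD('d)) choose n"
    unfolding L_def by (subst card_length_sum_list) simp
  also have "\<dots> = (n + CARD('d)) choose CARD('d)"
    using binomial_symmetric[of n "n + CARD('d)"] by simp
  finally show ?thesis .
qed

lemma mixed_deriv_0: "mixed_deriv \<beta> (\<lambda>x. 0) X = 0"
proof -
  have "mixed_deriv \<beta> (\<lambda>x. \<Sum>\<alpha>\<in>{}. 0 * monomial \<alpha> x) X = 0"
    unfolding mixed_deriv_polynomial by simp
  then show ?thesis by simp
qed

text \<open>The dimension count makes the system for the coefficients square. Since the monomials are linearly independent
  functions, a trivial kernel on functions is a trivial kernel on coefficients, which gives both existence and
  uniqueness.\<close>

lemma hermite_regular_if_kernel_0:
  fixes X :: "nat \<Rightarrow> real ^ 'd::finite"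
  assumes count: "(n + CARD('d)) choose CARD('d) = (\<Sum>q=1..m. (p q + CARD('d)) choose CARD('d))"
    and ker: "\<And>f. f \<in> polys (Suc n) \<Longrightarrow>
      (\<And>q \<alpha>. q \<in> {1..m} \<Longrightarrow> \<alpha> \<in> multi_indices (p q) \<Longrightarrow> mixed_deriv \<alpha> f (X q) = 0) \<Longrightarrow>
      \<forall>x. f x = 0"
  shows "hermite_regular n m p X"
  unfolding hermite_regular_def
proof (intro allI ex_ex1I)
  fix c :: "nat \<Rightarrow> ('d \<Rightarrow> nat) \<Rightarrow> real"
  define A where "A = (multi_indices n :: ('d \<Rightarrow> nat) set)"
  define B where "B = (SIGMA q:{1..m}. (multi_indices (p q) :: ('d \<Rightarrow> nat) set))"
  define F where "F a = (\<lambda>x :: real ^ 'd. \<Sum>\<alpha>\<in>A. a \<alpha> * monomial \<alpha> x)" for a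
  define M where "M qb \<alpha> = (\<Prod>j\<in>UNIV. deriv_power (snd qb j) (\<alpha> j) (X (fst qb) $ j))"
    for qb and \<alpha> :: "'d \<Rightarrow> nat"
  have F: "F a \<in> polys_total_degree n" for a
    unfolding polys_total_degree_def F_def A_def monomial_def by auto
  have derivs: "mixed_deriv \<beta> (F a) (X q) = (\<Sum>\<alpha>\<in>A. M (q, \<beta>) \<alpha> * a \<alpha>)" for q \<beta> a
    unfolding F_def mixed_deriv_polynomial M_def by (simp add: mult.commute)
  have fin: "finite A" "finite B" by (auto simp: A_def B_def finite_multi_indices)
  have "\<exists>a. \<forall>b\<in>B. (\<Sum>\<alpha>\<in>A. M b \<alpha> * a \<alpha>) = case_prod c b"
  proof (rule square_system_solvable[OF fin(2,1)])
    show "card B = card A"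
      by (simp add: A_def B_def finite_multi_indices card_multi_indices count)
  next
    fix a assume a: "\<forall>b\<in>B. (\<Sum>\<alpha>\<in>A. M b \<alpha> * a \<alpha>) = 0"
    have "\<forall>x. F a x = 0"
    proof (rule ker)
      show "F a \<in> polys (Suc n)" using F polys_total_degree_eq by blast
      show "mixed_deriv \<alpha> (F a) (X q) = 0" if "q \<in> {1..m}" "\<alpha> \<in> multi_indices (p q)" for q \<alpha>
        using a that by (simp add: derivs B_def)
    qed
    then have "F a = (\<lambda>x. 0)" by auto
    then have "mixed_deriv \<beta> (F a) 0 = 0" for \<beta> by (simp add: mixed_deriv_0)
    moreover have "mixed_deriv \<beta> (F a) 0 = a \<beta> * (\<Prod>j\<in>UNIV. fact (\<beta> j))" if "\<beta> \<in> A" for \<beta>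
      using mixed_deriv_taylor[OF fin(1), of "F a" 0 a \<beta>] that by (simp add: F_def)
    ultimately show "\<forall>\<beta>\<in>A. a \<beta> = 0" by auto
  qed
  then obtain a where "\<forall>b\<in>B. (\<Sum>\<alpha>\<in>A. M b \<alpha> * a \<alpha>) = case_prod c b" by auto
  then have "\<forall>q\<in>{1..m}. \<forall>\<alpha>\<in>multi_indices (p q). mixed_deriv \<alpha> (F a) (X q) = c q \<alpha>"
    by (auto simp: derivs B_def)
  with F show "\<exists>f. f \<in> polys_total_degree n \<and>
      (\<forall>q\<in>{1..m}. \<forall>\<alpha>\<in>multi_indices (p q). mixed_deriv \<alpha> f (X q) = c q \<alpha>)" by blast
next
  fix c :: "nat \<Rightarrow> ('d \<Rightarrow> nat) \<Rightarrow> real" and f g :: "real ^ 'd \<Rightarrow> real"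
  assume f: "f \<in> polys_total_degree n \<and>
      (\<forall>q\<in>{1..m}. \<forall>\<alpha>\<in>multi_indices (p q). mixed_deriv \<alpha> f (X q) = c q \<alpha>)"
    and g: "g \<in> polys_total_degree n \<and>
      (\<forall>q\<in>{1..m}. \<forall>\<alpha>\<in>multi_indices (p q). mixed_deriv \<alpha> g (X q) = c q \<alpha>)"
  obtain a where a: "f = (\<lambda>x. \<Sum>\<alpha>\<in>degs 0 (Suc n). a \<alpha> * monomial \<alpha> x)"
    using f unfolding polys_total_degree_eq poly_space_def by auto
  obtain b where b: "g = (\<lambda>x. \<Sum>\<alpha>\<in>degs 0 (Suc n). b \<alpha> * monomial \<alpha> x)"
    using g unfolding polys_total_degree_eq poly_space_def by auto
  have diff: "(\<lambda>x. f x - g x) = (\<lambda>x. \<Sum>\<alpha>\<in>degs 0 (Suc n). (a \<alpha> - b \<alpha>) * monomial \<alpha> x)"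
    unfolding a b by (simp add: sum_subtractf left_diff_distrib)
  have "mixed_deriv \<alpha> (\<lambda>x. f x - g x) x = mixed_deriv \<alpha> f x - mixed_deriv \<alpha> g x" for \<alpha> x
    unfolding diff unfolding a b mixed_deriv_polynomial
    by (simp add: sum_subtractf left_diff_distrib)
  then have "\<forall>x. f x - g x = 0"
    using f g by (intro ker) (auto simp: polys_total_degree_eq poly_space_diff)
  then show "f = g" by auto
qed

section \<open>The two obstructions to regularity\<close>

text \<open>Prescribe zero for all data except the derivative of order \<open>p b\<close> at \<open>X b\<close> in one
  coordinate direction in which the two nodes differ. A solution would vanish on the line to orders \<open>p a +
  1\<close> and \<open>p b\<close> at the two nodes, hence on the whole line, although its derivative of order
  \<open>p b\<close> along the line at \<open>X b\<close> is a nonzero multiple of the exceptional datum.\<close>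

lemma not_hermite_regular_if_line_overdetermined:
  fixes X :: "nat \<Rightarrow> real ^ 'd::finite"
  assumes "a \<in> {1..m}" "b \<in> {1..m}" "X a \<noteq> X b" "n \<le> p a + p b"
  shows "\<not> hermite_regular n m p X"
proof
  assume reg: "hermite_regular n m p X"
  define v where "v = X b - X a"
  obtain i where i: "v $ i \<noteq> 0"
    using \<open>X a \<noteq> X b\<close> unfolding v_def by (metis eq_iff_diff_eq_0 vec_eq_iff zero_index)
  define \<gamma> where "\<gamma> = (\<lambda>j. if j = i then p b else 0)"
  have sum_\<gamma>: "sum \<gamma> UNIV = p b" by (simp add: \<gamma>_def)
  define c :: "nat \<Rightarrow> ('d \<Rightarrow> nat) \<Rightarrow> real"
    where "c q \<alpha> = (if q = b \<and> \<alpha> = \<gamma> then 1 else 0)" for q \<alpha>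
  obtain f where f: "f \<in> polys (Suc n)"
    and derivs: "\<And>q \<alpha>. q \<in> {1..m} \<Longrightarrow> \<alpha> \<in> multi_indices (p q) \<Longrightarrow> mixed_deriv \<alpha> f (X q) = c q \<alpha>"
    using reg unfolding hermite_regular_def polys_total_degree_eq by blast
  have a: "vanishes_to_order (Suc (p a)) f (X a)"
    using derivs assms by (intro vanishes_to_order_if_derivs_0[OF f]) (auto simp: c_def)
  have b: "vanishes_to_order (p b) f (X b)"
  proof (cases "p b")
    case 0
    then show ?thesis
      using restrict_to_line[OF f, of "X b"] unfolding vanishes_to_order_def
      by (metis mult_1 power_0)
  next
    case (Suc k)
    show ?thesis unfolding Suc
    proof (rule vanishes_to_order_if_derivs_0[OF f])
      fix \<alpha> :: "'d \<Rightarrow> nat" assume "\<alpha> \<in> multi_indices k"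
      then have "\<alpha> \<in> multi_indices (p b)" "\<alpha> \<noteq> \<gamma>"
        using Suc sum_\<gamma> by (auto simp: multi_indices_def)
      then show "mixed_deriv \<alpha> f (X b) = 0" using derivs assms(2) by (simp add: c_def)
    qed
  qed
  have line: "f (X b + t *\<^sub>R v) = 0" for t
  proof -
    have "f (X a + (1 + t) *\<^sub>R v) = 0"
      unfolding v_def by (rule vanishes_on_line[OF f _ a b]) (use assms in simp)
    then show ?thesis by (simp add: v_def algebra_simps)
  qed
  obtain e where e: "\<And>y. f (X b + y) = (\<Sum>\<alpha>\<in>degs 0 (Suc n). e \<alpha> * monomial \<alpha> y)"
    using taylor_expansion[OF f, of "X b"] by metis
  have e_deriv: "mixed_deriv \<beta> f (X b) =
      (if \<beta> \<in> degs 0 (Suc n) then e \<beta> * (\<Prod>j\<in>UNIV. fact (\<beta> j)) else 0)" for \<beta>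
    using e by (rule mixed_deriv_taylor[OF finite_degs])
  have "mixed_deriv \<gamma> f (X b) = 1"
    using derivs[of b \<gamma>] assms(2) sum_\<gamma> by (simp add: c_def multi_indices_def)
  then have \<gamma>: "\<gamma> \<in> degs 0 (Suc n)" "e \<gamma> \<noteq> 0"
    using e_deriv[of \<gamma>] by (auto split: if_splits)
  have "e \<alpha> = 0" if "sum \<alpha> UNIV = p b" "\<alpha> \<noteq> \<gamma>" "\<alpha> \<in> degs 0 (Suc n)" for \<alpha>
    using derivs[of b \<alpha>] e_deriv[of \<alpha>] assms(2) that by (simp add: c_def multi_indices_def)
  then have "coeff (line_poly (Suc n) e v) (p b) =
      (\<Sum>\<alpha>\<in>degs 0 (Suc n). if \<alpha> = \<gamma> then e \<gamma> * monomial \<gamma> v else 0)"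
    unfolding coeff_line_poly using sum_\<gamma> by (intro sum.cong) auto
  also have "\<dots> = e \<gamma> * monomial \<gamma> v" using \<gamma>(1) by simp
  finally have coeff: "coeff (line_poly (Suc n) e v) (p b) = e \<gamma> * monomial \<gamma> v" .
  have "poly (line_poly (Suc n) e v) t = 0" for t
    unfolding poly_line_poly e[symmetric] by (rule line)
  then have "line_poly (Suc n) e v = 0" using poly_all_0_iff_0 by blast
  with coeff \<gamma>(2) have "monomial \<gamma> v = 0" by simp
  moreover have "monomial \<gamma> v = (v $ i) ^ p b"
    unfolding monomial_def \<gamma>_def by (simp add: if_distrib[of "\<lambda>k. _ ^ k"] prod.delta cong: if_cong)
  ultimately show False using i by simp
qed

text \<open>Write down \<open>N q\<close> consecutive copies of each \<open>q\<close> one after the other and deal them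
  out cyclically to \<open>n\<close> sets. No set receives two copies of one \<open>q\<close> because \<open>N q
  \<le> n\<close>, and no set receives more than \<open>d\<close> elements because the list has length at most
  \<open>d * n\<close>.\<close>

lemma cyclic_distribution:
  fixes N :: "nat \<Rightarrow> nat"
  assumes N: "\<And>q. q \<in> {1..m} \<Longrightarrow> N q \<le> n" and total: "(\<Sum>q=1..m. N q) \<le> d * n"
  obtains S where "\<And>j. S j \<subseteq> {1..m}" "\<And>j. card (S j) \<le> d"
    "\<And>q. q \<in> {1..m} \<Longrightarrow> N q \<le> card {j. j < n \<and> q \<in> S j}"
proof -
  define P where "P q = sum N {1..<q}" for q
  define block where "block q = {P q..<P q + N q}" for q
  define S where "S j = {q \<in> {1..m}. \<exists>u\<in>block q. u mod n = j}" for j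
  have P_Suc: "P (Suc q) = P q + N q" if "q \<ge> 1" for q
    using that by (simp add: P_def sum.atLeastLessThan_Suc)
  have P_mono: "P q \<le> P r" if "q \<le> r" for q r
    unfolding P_def using that by (intro sum_mono2) auto
  have block_less: "u < d * n" if "q \<in> {1..m}" "u \<in> block q" for q u
  proof -
    have "u < P (Suc q)" using that by (simp add: block_def P_Suc)
    also have "\<dots> \<le> P (Suc m)" using that by (intro P_mono) auto
    also have "\<dots> \<le> d * n" using total by (simp add: P_def atLeastLessThanSuc_atLeastAtMost)
    finally show ?thesis .
  qed
  have disjoint: "False" if "q \<in> {1..m}" "r \<in> {1..m}" "q < r" "u \<in> block q" "u \<in> block r" for q r u
    using that P_mono[of "Suc q" r] by (simp add: block_def P_Suc)
  show thesis
  proof (rule that[of S])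
    show "S j \<subseteq> {1..m}" for j by (auto simp: S_def)
    show "card (S j) \<le> d" for j
    proof -
      define U where "U q = (SOME u. u \<in> block q \<and> u mod n = j)" for q
      have U: "U q \<in> block q" "U q mod n = j" if "q \<in> S j" for q
      proof -
        have "\<exists>u. u \<in> block q \<and> u mod n = j" using that by (auto simp: S_def)
        from someI_ex[OF this] show "U q \<in> block q" "U q mod n = j" by (auto simp: U_def)
      qed
      have "inj_on (\<lambda>q. U q div n) (S j)"
      proof (rule inj_onI)
        fix q r assume qr: "q \<in> S j" "r \<in> S j" "U q div n = U r div n"
        then have "U q = U r" using U(2) by (metis div_mult_mod_eq)
        then show "q = r"
          using disjoint[of q r "U q"] disjoint[of r q "U q"] U(1) qr(1,2)
          by (metis (no_types, lifting) S_def linorder_neqE_nat mem_Collect_eq)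
      qed
      moreover have "(\<lambda>q. U q div n) ` S j \<subseteq> {..<d}"
      proof safe
        fix q assume "q \<in> S j"
        then have "U q < d * n" using block_less U(1) by (auto simp: S_def)
        then show "U q div n < d" by (simp add: less_mult_imp_div_less)
      qed
      ultimately show ?thesis by (metis card_inj_on_le card_lessThan finite_lessThan)
    qed
    show "N q \<le> card {j. j < n \<and> q \<in> S j}" if "q \<in> {1..m}" for q
    proof -
      have "inj_on (\<lambda>u. u mod n) (block q)"
      proof (rule inj_onI)
        fix u w assume uw: "u \<in> block q" "w \<in> block q" "u mod n = w mod n"
        then have "\<bar>int u - int w\<bar> < int n" using N[OF that] by (auto simp: block_def)
        moreover have "int n dvd int u - int w"
          using uw(3) by (metis mod_eq_dvd_iff of_nat_mod)
        ultimately show "u = w" using zdvd_imp_le[of "int n" "\<bar>int u - int w\<bar>"] by force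
      qed
      then have "N q = card ((\<lambda>u. u mod n) ` block q)" by (simp add: card_image block_def)
      also have "\<dots> \<le> card {j. j < n \<and> q \<in> S j}"
      proof (rule card_mono)
        show "(\<lambda>u. u mod n) ` block q \<subseteq> {j. j < n \<and> q \<in> S j}"
        proof safe
          fix u assume u: "u \<in> block q"
          then have "N q > 0" by (simp add: block_def)
          then show "u mod n < n" using N[OF that] by simp
          show "q \<in> S (u mod n)" using u that by (auto simp: S_def)
        qed
      qed simp
      finally show ?thesis .
    qed
  qed
qed

lemma prod_affine_in_degs:
  assumes "finite J" "\<And>j. j \<in> J \<Longrightarrow> h j \<in> poly_space (degs (k j) (Suc (Suc 0)))"
  shows "(\<lambda>y. \<Prod>j\<in>J. h j y) \<in> poly_space (degs (\<Sum>j\<in>J. k j) (Suc (card J)))"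
  using assms
proof (induction J rule: finite_induct)
  case (insert j J)
  then show ?case using degs_mult[of "h j" "k j" "Suc (Suc 0)" _ _ "card J"] by simp
qed (simp add: const_in_polys)

text \<open>Any \<open>d\<close> points lie on a hyperplane, so each set of the cyclic distribution gives a hyperplane;
  the product of the \<open>n\<close> equations vanishes at every node to the required order and is not
  identically zero, since finitely many hyperplanes do not cover the space.\<close>

lemma not_hermite_regular_if_hyperplanes:
  fixes X :: "nat \<Rightarrow> real ^ 'd::finite"
  assumes "\<And>q. q \<in> {1..m} \<Longrightarrow> Suc (p q) \<le> n" and "(\<Sum>q=1..m. Suc (p q)) \<le> CARD('d) * n"
  shows "\<not> hermite_regular n m p X"
proof -
  obtain S where S: "\<And>j. S j \<subseteq> {1..m}" "\<And>j. card (S j) \<le> CARD('d)"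
    "\<And>q. q \<in> {1..m} \<Longrightarrow> Suc (p q) \<le> card {j. j < n \<and> q \<in> S j}"
    using cyclic_distribution[of m "\<lambda>q. Suc (p q)" n "CARD('d)"] assms by blast
  have "\<exists>u c. u \<noteq> 0 \<and> X ` S j \<subseteq> {x. u \<bullet> x = c}" for j
  proof -
    have fin: "finite (S j)" using S(1) finite_subset by blast
    have "aff_dim (X ` S j) \<le> int (card (X ` S j)) - 1"
      by (rule aff_dim_le_card) (use fin in simp)
    also have "\<dots> < int DIM(real ^ 'd)" using card_image_le[OF fin, of X] S(2)[of j] by simp
    finally show ?thesis by (metis aff_lowdim_subset_hyperplane)
  qed
  then obtain u c where u: "\<And>j. u j \<noteq> 0" and uc: "\<And>j. X ` S j \<subseteq> {x. u j \<bullet> x = c j}" by metis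
  define f where "f x = (\<Prod>j<n. u j \<bullet> x - c j)" for x
  have factor: "(\<lambda>y. u j \<bullet> (X q + y) - c j) \<in>
      poly_space (degs (if q \<in> S j then 1 else 0) (Suc (Suc 0)))" for q j
  proof (cases "q \<in> S j")
    case True
    then have "u j \<bullet> X q = c j" using uc[of j] by auto
    then show ?thesis using True linear_in_degs[of "u j"] by (simp add: inner_add_right)
  next
    case False
    then show ?thesis using affine_in_polys[of "u j" "u j \<bullet> X q - c j"]
      by (simp add: inner_add_right algebra_simps)
  qed
  have "(\<lambda>y. u j \<bullet> y - c j) \<in> poly_space (degs 0 (Suc (Suc 0)))" for j
    using affine_in_polys[of "u j" "- c j"] by simp
  then have f_polys: "f \<in> polys_total_degree n"
    using prod_affine_in_degs[of "{..<n}" "\<lambda>j y. u j \<bullet> y - c j" "\<lambda>_. 0"]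
    unfolding polys_total_degree_eq f_def by simp
  have derivs: "mixed_deriv \<alpha> f (X q) = 0" if "q \<in> {1..m}" "\<alpha> \<in> multi_indices (p q)" for q \<alpha>
  proof -
    let ?k = "\<Sum>j<n. if q \<in> S j then 1 else 0"
    have "?k = card {j. j < n \<and> q \<in> S j}"
      by (simp add: sum.If_cases lessThan_def Collect_conj_eq)
    then have "Suc (p q) \<le> ?k" using S(3)[OF that(1)] by simp
    then have "\<alpha> \<notin> degs ?k (Suc n)" using that(2) by (simp add: multi_indices_def)
    moreover have "(\<lambda>y. f (X q + y)) \<in> poly_space (degs ?k (Suc n))"
      using prod_affine_in_degs[of "{..<n}" "\<lambda>j y. u j \<bullet> (X q + y) - c j"] factor
      unfolding f_def by simp
    then obtain b where "\<And>y. f (X q + y) = (\<Sum>\<alpha>\<in>degs ?k (Suc n). b \<alpha> * monomial \<alpha> y)"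
      unfolding poly_space_def by (auto dest: fun_cong)
    ultimately show ?thesis by (subst mixed_deriv_taylor) auto
  qed
  have "negligible (\<Union>j<n. {x. u j \<bullet> x = c j})"
    using u by (intro negligible_Union) (auto intro: negligible_hyperplane)
  then have "(\<Union>j<n. {x. u j \<bullet> x = c j}) \<noteq> UNIV" using non_negligible_UNIV by metis
  then obtain x where "\<forall>j<n. u j \<bullet> x \<noteq> c j" by blast
  then have "f x \<noteq> 0" by (simp add: f_def)
  then have "f \<noteq> (\<lambda>x. 0)" by auto
  moreover have "(\<lambda>x. 0) \<in> polys_total_degree n"
    by (simp add: polys_total_degree_eq poly_space_0)
  ultimately have two: "\<not> (\<exists>!f. f \<in> polys_total_degree n \<and>
      (\<forall>q\<in>{1..m}. \<forall>\<alpha>\<in>multi_indices (p q). mixed_deriv \<alpha> f (X q) = 0))"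
    using f_polys derivs mixed_deriv_0 by blast
  show ?thesis
    unfolding hermite_regular_def
    by (rule notI, drule spec[of _ "\<lambda>_ _. 0"]) (use two in simp)
qed

section \<open>Curves through four points of the plane\<close>

text \<open>In the plane, this says that the three points are not collinear. The barycentric form is symmetric in the
  points.\<close>

definition affinely_spanning :: "real ^ 'd::finite \<Rightarrow> real ^ 'd \<Rightarrow> real ^ 'd \<Rightarrow> bool" where
  "affinely_spanning a b c \<longleftrightarrow>
    (\<forall>x. \<exists>r s t. r + s + t = 1 \<and> x = r *\<^sub>R a + s *\<^sub>R b + t *\<^sub>R c)"

lemma affinely_spanning_perms:
  assumes "affinely_spanning a b c"
  shows "affinely_spanning a c b" "affinely_spanning b a c" "affinely_spanning b c a"
    "affinely_spanning c a b" "affinely_spanning c b a"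
proof -
  have rot: "affinely_spanning b c a" if span: "affinely_spanning a b c" for a b c :: "real ^ 'a"
    unfolding affinely_spanning_def
  proof
    fix x
    obtain r s t where "r + s + t = 1" "x = r *\<^sub>R a + s *\<^sub>R b + t *\<^sub>R c"
      using span[unfolded affinely_spanning_def, rule_format, of x] by metis
    then show "\<exists>r s t. r + s + t = 1 \<and> x = r *\<^sub>R b + s *\<^sub>R c + t *\<^sub>R a"
      by (intro exI[of _ s] exI[of _ t] exI[of _ r]) (simp add: algebra_simps)
  qed
  have swap: "affinely_spanning b a c" if span: "affinely_spanning a b c" for a b c :: "real ^ 'a"
    unfolding affinely_spanning_def
  proof
    fix x
    obtain r s t where "r + s + t = 1" "x = r *\<^sub>R a + s *\<^sub>R b + t *\<^sub>R c"
      using span[unfolded affinely_spanning_def, rule_format, of x] by metis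
    then show "\<exists>r s t. r + s + t = 1 \<and> x = r *\<^sub>R b + s *\<^sub>R a + t *\<^sub>R c"
      by (intro exI[of _ s] exI[of _ r] exI[of _ t]) (simp add: algebra_simps)
  qed
  show "affinely_spanning a c b" by (rule swap[OF rot[OF rot[OF assms]]])
  show "affinely_spanning b a c" by (rule swap[OF assms])
  show "affinely_spanning b c a" by (rule rot[OF assms])
  show "affinely_spanning c a b" by (rule rot[OF rot[OF assms]])
  show "affinely_spanning c b a" by (rule swap[OF rot[OF assms]])
qed

definition quadrangle :: "real ^ 'd::finite \<Rightarrow> real ^ 'd \<Rightarrow> real ^ 'd \<Rightarrow> real ^ 'd \<Rightarrow> bool" where
  "quadrangle a b c d \<longleftrightarrow> affinely_spanning a b c \<and> affinely_spanning a b d \<and>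
    affinely_spanning a c d \<and> affinely_spanning b c d"

lemma polys_0: "f \<in> polys 0 \<Longrightarrow> f x = 0"
  unfolding poly_space_def degs_def by auto

text \<open>The basic reduction step. The orders at \<open>a\<close> and \<open>b\<close> add up to more than the degree
  of \<open>f\<close>, so \<open>f\<close> vanishes on the line \<open>a b\<close> and is divisible by its
  equation; orders at points off that line survive. The point \<open>c\<close> witnesses that \<open>a\<close>
  and \<open>b\<close> span a line, so that the zero set of the equation is exactly that line.\<close>

lemma split_off_line:
  fixes f :: "real ^ 'd::finite \<Rightarrow> real"
  assumes card: "CARD('d) = 2" and f: "f \<in> polys s"
    and orders: "vanishes_to_order M f a" "vanishes_to_order N f b" and le: "s \<le> M + N"
    and span: "affinely_spanning a b c"
  obtains g where "g \<in> polys (s - 1)" "(\<forall>x. g x = 0) \<Longrightarrow> (\<forall>x. f x = 0)"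
    "vanishes_to_order (M - 1) g a" "vanishes_to_order (N - 1) g b"
    "\<And>L z. affinely_spanning a b z \<Longrightarrow> vanishes_to_order L f z \<Longrightarrow> vanishes_to_order L g z"
proof -
  have "aff_dim {a, b} \<le> int (card {a, b}) - 1" by (rule aff_dim_le_card) simp
  also have "\<dots> < int DIM(real ^ 'd)" using card card_insert_le_m1[of 2 "{b}" a] by (simp add: card_insert_if)
  finally obtain u k where "u \<noteq> 0" "{a, b} \<subseteq> {x. u \<bullet> x = k}"
    by (metis aff_lowdim_subset_hyperplane)
  then have u: "u \<noteq> 0" "u \<bullet> a = k" "u \<bullet> b = k" by auto
  have off: "u \<bullet> z \<noteq> k" if span_z: "affinely_spanning a b z" for z
  proof
    assume z: "u \<bullet> z = k"
    have "u \<bullet> x = k" for x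
    proof -
      obtain r s t where "r + s + t = 1" "x = r *\<^sub>R a + s *\<^sub>R b + t *\<^sub>R z"
        using span_z[unfolded affinely_spanning_def, rule_format, of x] by metis
      then have "u \<bullet> x = r * k + s * k + t * k" using u z by (simp add: inner_add_right)
      then have "u \<bullet> x = (r + s + t) * k" by (simp only: distrib_right)
      with \<open>r + s + t = 1\<close> show ?thesis by simp
    qed
    from this[of 0] this[of u] u show False by simp
  qed
  have on_line: "f x = 0" if "u \<bullet> x = k" for x
  proof -
    obtain r s t where rst: "r + s + t = 1" "x = r *\<^sub>R a + s *\<^sub>R b + t *\<^sub>R c"
      using span[unfolded affinely_spanning_def, rule_format, of x] by metis
    have "k = (r + s) * k + t * (u \<bullet> c)"
      using that u unfolding rst(2) by (simp add: inner_add_right algebra_simps)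
    moreover have "r + s = 1 - t" using rst(1) by simp
    ultimately have "t * (u \<bullet> c - k) = 0" by algebra
    then have "t = 0" using off[OF span] by auto
    with rst have "r = 1 - s" "x = r *\<^sub>R a + s *\<^sub>R b" by simp_all
    then have "x = (1 - s) *\<^sub>R a + s *\<^sub>R b" by (simp only:)
    then have "x = a + s *\<^sub>R (b - a)" by (simp add: algebra_simps)
    then show ?thesis using vanishes_on_line[OF f le orders] by simp
  qed
  have "\<exists>g\<in>polys (s - 1). \<forall>x. f x = (u \<bullet> x - k) * g x"
  proof (cases s)
    case 0
    then show ?thesis
      using f polys_0 by (intro bexI[of _ "\<lambda>_. 0"]) (auto simp: poly_space_0)
  next
    case (Suc s')
    then show ?thesis using polys_division[of f s' u k] f u(1) on_line by auto
  qed
  then obtain g where g: "g \<in> polys (s - 1)" "\<And>x. f x = (u \<bullet> x - k) * g x" by blast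
  show thesis
  proof (rule that[OF g(1)])
    show "\<forall>x. g x = 0 \<Longrightarrow> \<forall>x. f x = 0" using g(2) by simp
    show "vanishes_to_order (M - 1) g a" "vanishes_to_order (N - 1) g b"
      using vanishes_to_order_cofactor(2)[OF g _ u(1)] orders by blast+
    show "vanishes_to_order L g z" if "affinely_spanning a b z" "vanishes_to_order L f z" for L z
      using vanishes_to_order_cofactor(1)[OF g that(2) u(1) off[OF that(1)]] .
  qed
qed

text \<open>Divide by the sides \<open>a b\<close>, \<open>a c\<close>, \<open>b c\<close> in turn: each side again meets
  the current quotient too often.\<close>

lemma quadrangle_reduction_B:
  fixes f :: "real ^ 'd::finite \<Rightarrow> real"
  assumes card: "CARD('d) = 2" and quad: "quadrangle a b c d" and f: "f \<in> polys (2 * M)"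
    and orders: "vanishes_to_order M f a" "vanishes_to_order M f b" "vanishes_to_order M f c"
      "vanishes_to_order (M - 1) f d"
  obtains g where "g \<in> polys (2 * M - 3)" "(\<forall>x. g x = 0) \<Longrightarrow> (\<forall>x. f x = 0)"
    "vanishes_to_order (M - 2) g a" "vanishes_to_order (M - 2) g b"
    "vanishes_to_order (M - 2) g c" "vanishes_to_order (M - 1) g d"
proof -
  have sp: "affinely_spanning a b c" "affinely_spanning a b d"
    "affinely_spanning a c b" "affinely_spanning a c d"
    "affinely_spanning b c a" "affinely_spanning b c d"
    using quad unfolding quadrangle_def by (auto intro: affinely_spanning_perms)
  have "2 * M \<le> M + M" by simp
  from split_off_line[OF card f orders(1,2) this sp(1)]
  obtain g where g: "g \<in> polys (2 * M - 1)" "(\<forall>x. g x = 0) \<Longrightarrow> (\<forall>x. f x = 0)"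
    "vanishes_to_order (M - 1) g a" "vanishes_to_order (M - 1) g b"
    and g_off: "\<And>L z. affinely_spanning a b z \<Longrightarrow> vanishes_to_order L f z \<Longrightarrow> vanishes_to_order L g z"
    by metis
  note g_c = g_off[OF sp(1) orders(3)] and g_d = g_off[OF sp(2) orders(4)]
  have "2 * M - 1 \<le> (M - 1) + M" by simp
  from split_off_line[OF card g(1) g(3) g_c this sp(3)]
  obtain h where h: "h \<in> polys (2 * M - 1 - 1)" "(\<forall>x. h x = 0) \<Longrightarrow> (\<forall>x. g x = 0)"
    "vanishes_to_order (M - 1 - 1) h a" "vanishes_to_order (M - 1) h c"
    and h_off: "\<And>L z. affinely_spanning a c z \<Longrightarrow> vanishes_to_order L g z \<Longrightarrow> vanishes_to_order L h z"
    by metis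
  note h_b = h_off[OF sp(3) g(4)] and h_d = h_off[OF sp(4) g_d]
  have "2 * M - 1 - 1 \<le> (M - 1) + (M - 1)" by simp
  from split_off_line[OF card h(1) h_b h(4) this sp(5)]
  obtain e where e: "e \<in> polys (2 * M - 1 - 1 - 1)" "(\<forall>x. e x = 0) \<Longrightarrow> (\<forall>x. h x = 0)"
    "vanishes_to_order (M - 1 - 1) e b" "vanishes_to_order (M - 1 - 1) e c"
    and e_off: "\<And>L z. affinely_spanning b c z \<Longrightarrow> vanishes_to_order L h z \<Longrightarrow> vanishes_to_order L e z"
    by metis
  note e_a = e_off[OF sp(5) h(3)] and e_d = e_off[OF sp(6) h_d]
  have arith: "2 * M - 1 - 1 - 1 = 2 * M - 3" "M - 1 - 1 = M - 2" by simp_all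
  show thesis
    using that[of e] e(1,3,4) e_a e_d e(2) h(2) g(2) unfolding arith by blast
qed

text \<open>Divide by the lines \<open>a d\<close>, \<open>b d\<close>, \<open>c d\<close> in turn.\<close>

lemma quadrangle_reduction_A:
  fixes f :: "real ^ 'd::finite \<Rightarrow> real"
  assumes card: "CARD('d) = 2" and quad: "quadrangle a b c d" and f: "f \<in> polys (2 * N + 1)"
    and orders: "vanishes_to_order N f a" "vanishes_to_order N f b" "vanishes_to_order N f c"
      "vanishes_to_order (N + 1) f d"
  obtains g where "g \<in> polys (2 * (N - 1))" "(\<forall>x. g x = 0) \<Longrightarrow> (\<forall>x. f x = 0)"
    "vanishes_to_order (N - 1) g a" "vanishes_to_order (N - 1) g b"
    "vanishes_to_order (N - 1) g c" "vanishes_to_order (N - 1 - 1) g d"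
proof -
  have sp: "affinely_spanning a d b" "affinely_spanning a d c"
    "affinely_spanning b d a" "affinely_spanning b d c"
    "affinely_spanning c d a" "affinely_spanning c d b"
    using quad unfolding quadrangle_def by (auto intro: affinely_spanning_perms)
  have "2 * N + 1 \<le> N + (N + 1)" by simp
  from split_off_line[OF card f orders(1,4) this sp(1)]
  obtain g where g: "g \<in> polys (2 * N + 1 - 1)" "(\<forall>x. g x = 0) \<Longrightarrow> (\<forall>x. f x = 0)"
    "vanishes_to_order (N - 1) g a" "vanishes_to_order (N + 1 - 1) g d"
    and g_off: "\<And>L z. affinely_spanning a d z \<Longrightarrow> vanishes_to_order L f z \<Longrightarrow> vanishes_to_order L g z"
    by metis
  note g_b = g_off[OF sp(1) orders(2)] and g_c = g_off[OF sp(2) orders(3)]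
  have "2 * N + 1 - 1 \<le> N + (N + 1 - 1)" by simp
  from split_off_line[OF card g(1) g_b g(4) this sp(3)]
  obtain h where h: "h \<in> polys (2 * N + 1 - 1 - 1)" "(\<forall>x. h x = 0) \<Longrightarrow> (\<forall>x. g x = 0)"
    "vanishes_to_order (N - 1) h b" "vanishes_to_order (N + 1 - 1 - 1) h d"
    and h_off: "\<And>L z. affinely_spanning b d z \<Longrightarrow> vanishes_to_order L g z \<Longrightarrow> vanishes_to_order L h z"
    by metis
  note h_a = h_off[OF sp(3) g(3)] and h_c = h_off[OF sp(4) g_c]
  have "2 * N + 1 - 1 - 1 \<le> N + (N + 1 - 1 - 1)" by simp
  from split_off_line[OF card h(1) h_c h(4) this sp(5)]
  obtain e where e: "e \<in> polys (2 * N + 1 - 1 - 1 - 1)" "(\<forall>x. e x = 0) \<Longrightarrow> (\<forall>x. h x = 0)"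
    "vanishes_to_order (N - 1) e c" "vanishes_to_order (N + 1 - 1 - 1 - 1) e d"
    and e_off: "\<And>L z. affinely_spanning c d z \<Longrightarrow> vanishes_to_order L h z \<Longrightarrow> vanishes_to_order L e z"
    by metis
  note e_a = e_off[OF sp(5) h_a] and e_b = e_off[OF sp(6) h(3)]
  have arith: "2 * N + 1 - 1 - 1 - 1 = 2 * (N - 1)" "N + 1 - 1 - 1 - 1 = N - 1 - 1" by simp_all
  show thesis
    using that[of e] e(1,3,4) e_a e_b e(2) h(2) g(2) unfolding arith by blast
qed

text \<open>The two reductions together lower \<open>N\<close> by three and the degree by six. For \<open>N < 3\<close>
  truncated subtraction ends in the zero space.\<close>

lemma quadrangle_unisolvent_A:
  fixes f :: "real ^ 'd::finite \<Rightarrow> real"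
  assumes card: "CARD('d) = 2" and quad: "quadrangle a b c d" and "f \<in> polys (2 * N + 1)"
    and "vanishes_to_order N f a" "vanishes_to_order N f b" "vanishes_to_order N f c"
      "vanishes_to_order (N + 1) f d"
  shows "\<forall>x. f x = 0"
  using assms(3-)
proof (induction N arbitrary: f rule: less_induct)
  case (less N)
  obtain g where g: "g \<in> polys (2 * (N - 1))" "(\<forall>x. g x = 0) \<Longrightarrow> (\<forall>x. f x = 0)"
    "vanishes_to_order (N - 1) g a" "vanishes_to_order (N - 1) g b"
    "vanishes_to_order (N - 1) g c" "vanishes_to_order (N - 1 - 1) g d"
    by (rule quadrangle_reduction_A[OF card quad less.prems]) blast
  obtain h where h: "h \<in> polys (2 * (N - 1) - 3)" "(\<forall>x. h x = 0) \<Longrightarrow> (\<forall>x. g x = 0)"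
    "vanishes_to_order (N - 1 - 2) h a" "vanishes_to_order (N - 1 - 2) h b"
    "vanishes_to_order (N - 1 - 2) h c" "vanishes_to_order (N - 1 - 1) h d"
    by (rule quadrangle_reduction_B[OF card quad g(1,3-6)]) blast
  have "\<forall>x. h x = 0"
  proof (cases "N \<ge> 3")
    case True
    then have "2 * (N - 1) - 3 = 2 * (N - 3) + 1" "N - 1 - 2 = N - 3" "N - 1 - 1 = N - 3 + 1"
      by auto
    with h(1,3-6) show ?thesis using True by (intro less.IH[of "N - 3"]) simp_all
  next
    case False
    then have "2 * (N - 1) - 3 = 0 \<or> N = 3" by auto
    then have "2 * (N - 1) - 3 = 0" using False by simp
    then have "h \<in> polys 0" using h(1) by metis
    then show ?thesis using polys_0 by blast
  qed
  then show ?case using g(2) h(2) by blast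
qed

lemma quadrangle_unisolvent_B:
  fixes f :: "real ^ 'd::finite \<Rightarrow> real"
  assumes card: "CARD('d) = 2" and quad: "quadrangle a b c d" and f: "f \<in> polys (2 * M)"
    and orders: "vanishes_to_order M f a" "vanishes_to_order M f b" "vanishes_to_order M f c"
      "vanishes_to_order (M - 1) f d" and "M \<ge> 2"
  shows "\<forall>x. f x = 0"
proof -
  obtain g where g: "g \<in> polys (2 * M - 3)" "(\<forall>x. g x = 0) \<Longrightarrow> (\<forall>x. f x = 0)"
    "vanishes_to_order (M - 2) g a" "vanishes_to_order (M - 2) g b"
    "vanishes_to_order (M - 2) g c" "vanishes_to_order (M - 1) g d"
    by (rule quadrangle_reduction_B[OF card quad f orders]) blast
  have "2 * M - 3 = 2 * (M - 2) + 1" "M - 1 = M - 2 + 1" using \<open>M \<ge> 2\<close> by auto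
  then have "\<forall>x. g x = 0"
    using g(1,3-6) by (intro quadrangle_unisolvent_A[OF card quad, of g "M - 2"]) simp_all
  then show ?thesis by (rule g(2))
qed

section \<open>Cubic surfaces with five double points\<close>

definition plane_point :: "real ^ 'd \<Rightarrow> real ^ 'd \<Rightarrow> real ^ 'd \<Rightarrow> real ^ 2 \<Rightarrow> real ^ 'd::finite" where
  "plane_point a v w y = a + y $ 1 *\<^sub>R v + y $ 2 *\<^sub>R w"

lemma polys_plane_point:
  assumes "f \<in> polys s"
  shows "(\<lambda>y. f (plane_point a v w y)) \<in> polys s"
proof (rule polys_compose[OF assms])
  fix i
  have "plane_point a v w y $ i = (v $ i *\<^sub>R axis 1 1 + w $ i *\<^sub>R axis 2 1) \<bullet> y + a $ i" for y
    by (simp add: plane_point_def inner_add_left inner_axis')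
  then show "(\<lambda>y. plane_point a v w y $ i) \<in> polys (Suc (Suc 0))"
    by (simp only: affine_in_polys)
qed

lemma vanishes_to_order_plane_point:
  assumes "vanishes_to_order N f (plane_point a v w y)"
  shows "vanishes_to_order N (\<lambda>y. f (plane_point a v w y)) y"
  using assms
  by (rule vanishes_to_order_compose[where L = "plane_point 0 v w"])
     (simp add: plane_point_def algebra_simps)

lemma quadrangle_standard:
  assumes "r \<noteq> 0" "s \<noteq> 0" "r + s \<noteq> 1"
  shows "quadrangle 0 (vector [1, 0]) (vector [0, 1]) (vector [r, s] :: real ^ 2)"
proof -
  have ex: "\<exists>l m t. l + m + t = 1 \<and> P l m t" if "P (1 - m - t) m t"
    for P :: "real \<Rightarrow> real \<Rightarrow> real \<Rightarrow> bool" and m t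
    using that by (intro exI[of _ "1 - m - t"] exI[of _ m] exI[of _ t]) simp
  have nz: "r + s - 1 \<noteq> 0" using assms by simp
  have "affinely_spanning 0 (vector [1, 0]) (vector [0, 1] :: real ^ 2)"
    unfolding affinely_spanning_def
    by (rule allI, rule_tac m = "x $ 1" and t = "x $ 2" in ex) (simp add: vec_eq_iff forall_2)
  moreover have "affinely_spanning 0 (vector [1, 0]) (vector [r, s] :: real ^ 2)"
    unfolding affinely_spanning_def
    by (rule allI, rule_tac m = "x $ 1 - x $ 2 / s * r" and t = "x $ 2 / s" in ex)
       (simp add: vec_eq_iff forall_2 assms)
  moreover have "affinely_spanning 0 (vector [0, 1]) (vector [r, s] :: real ^ 2)"
    unfolding affinely_spanning_def
    by (rule allI, rule_tac m = "x $ 2 - x $ 1 / r * s" and t = "x $ 1 / r" in ex)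
       (simp add: vec_eq_iff forall_2 assms)
  moreover have "affinely_spanning (vector [1, 0]) (vector [0, 1]) (vector [r, s] :: real ^ 2)"
    unfolding affinely_spanning_def
  proof (rule allI)
    fix x :: "real ^ 2"
    define t where "t = (x $ 1 + x $ 2 - 1) / (r + s - 1)"
    have t: "t * (r + s - 1) = x $ 1 + x $ 2 - 1" using nz by (simp add: t_def)
    show "\<exists>l m t. l + m + t = 1 \<and>
        x = l *\<^sub>R vector [1, 0] + m *\<^sub>R vector [0, 1] + t *\<^sub>R vector [r, s]"
      by (rule ex[of _ "x $ 2 - t * s" t])
         (use t in \<open>simp add: vec_eq_iff forall_2 algebra_simps\<close>)
  qed
  ultimately show ?thesis unfolding quadrangle_def by blast
qed

text \<open>A fourth zero in the plane, besides the three nodes, brings the restriction of \<open>f\<close> within reach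
  of the planar results: the orders \<open>(2, 2, 2, 1)\<close> for cubics and \<open>(1, 1, 2, 1)\<close> for
  conics.\<close>

lemma zero_on_plane:
  fixes f :: "real ^ 'd::finite \<Rightarrow> real"
  assumes f: "f \<in> polys (s + 1)" and rt: "r \<noteq> 0" "t \<noteq> 0" "r + t \<noteq> 1"
    and z: "f (a + r *\<^sub>R v + t *\<^sub>R w) = 0"
    and orders: "s = 3 \<and> vanishes_to_order 2 f a \<and> vanishes_to_order 2 f (a + v) \<and>
        vanishes_to_order 2 f (a + w) \<or>
      s = 2 \<and> vanishes_to_order 1 f a \<and> vanishes_to_order 1 f (a + v) \<and>
        vanishes_to_order 2 f (a + w)"
  shows "f (a + x *\<^sub>R v + y *\<^sub>R w) = 0"
proof -
  let ?P = "plane_point a v w"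
  define F where "F = (\<lambda>y. f (?P y))"
  have F: "F \<in> polys (s + 1)" unfolding F_def by (rule polys_plane_point[OF f])
  have pts: "?P 0 = a" "?P (vector [1, 0]) = a + v" "?P (vector [0, 1]) = a + w"
    "?P (vector [r, t]) = a + r *\<^sub>R v + t *\<^sub>R w" "?P (vector [x, y]) = a + x *\<^sub>R v + y *\<^sub>R w"
    by (simp_all add: plane_point_def)
  have order: "vanishes_to_order k F y" if "vanishes_to_order k f (?P y)" for k y
    unfolding F_def using that by (rule vanishes_to_order_plane_point)
  have z1: "vanishes_to_order 1 F (vector [r, t])"
    using vanishes_to_order_1[OF F] z by (simp add: F_def pts)
  have quad: "quadrangle 0 (vector [1, 0]) (vector [0, 1]) (vector [r, t] :: real ^ 2)"
    using rt by (rule quadrangle_standard)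
  from orders have "\<forall>y. F y = 0"
  proof
    assume o: "s = 3 \<and> vanishes_to_order 2 f a \<and> vanishes_to_order 2 f (a + v) \<and>
        vanishes_to_order 2 f (a + w)"
    show ?thesis
      using o z1 F pts
      by (intro quadrangle_unisolvent_B[OF _ quad, of _ 2]) (auto intro!: order)
  next
    assume o: "s = 2 \<and> vanishes_to_order 1 f a \<and> vanishes_to_order 1 f (a + v) \<and>
        vanishes_to_order 2 f (a + w)"
    have quad': "quadrangle 0 (vector [1, 0]) (vector [r, t]) (vector [0, 1] :: real ^ 2)"
      using quad unfolding quadrangle_def by (auto intro: affinely_spanning_perms)
    show ?thesis
      using o z1 F pts
      by (intro quadrangle_unisolvent_A[OF _ quad', of _ 1]) (auto intro!: order simp: numeral_2_eq_2 numeral_3_eq_3)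
  qed
  then have "F (vector [x, y]) = 0" by blast
  then show ?thesis by (simp only: F_def pts)
qed

lemma split_off_plane:
  fixes f :: "real ^ 'd::finite \<Rightarrow> real"
  assumes card: "CARD('d) = 3" and f: "f \<in> polys (Suc s)"
    and span: "\<And>x. \<exists>\<alpha> \<beta> \<gamma>. x = \<alpha> *\<^sub>R v + \<beta> *\<^sub>R w + \<gamma> *\<^sub>R e"
    and zero: "\<And>\<alpha> \<beta>. f (a + \<alpha> *\<^sub>R v + \<beta> *\<^sub>R w) = 0"
  obtains g where "g \<in> polys s" "(\<forall>x. g x = 0) \<Longrightarrow> (\<forall>x. f x = 0)"
    "\<And>N x. vanishes_to_order N f x \<Longrightarrow> vanishes_to_order (N - 1) g x"
    "\<And>N \<alpha> \<beta> \<gamma>. \<gamma> \<noteq> 0 \<Longrightarrow> vanishes_to_order N f (a + \<alpha> *\<^sub>R v + \<beta> *\<^sub>R w + \<gamma> *\<^sub>R e) \<Longrightarrow>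
      vanishes_to_order N g (a + \<alpha> *\<^sub>R v + \<beta> *\<^sub>R w + \<gamma> *\<^sub>R e)"
proof -
  have "aff_dim {a, a + v, a + w} \<le> int (card {a, a + v, a + w}) - 1"
    by (rule aff_dim_le_card) simp
  also have "\<dots> < int DIM(real ^ 'd)" using card by (simp add: card_insert_if)
  finally obtain u k where "u \<noteq> 0" "{a, a + v, a + w} \<subseteq> {x. u \<bullet> x = k}"
    by (metis aff_lowdim_subset_hyperplane)
  then have u: "u \<noteq> 0" "u \<bullet> a = k" "u \<bullet> v = 0" "u \<bullet> w = 0" by (auto simp: inner_add_right)
  have "u \<bullet> e \<noteq> 0"
  proof
    assume "u \<bullet> e = 0"
    then have "u \<bullet> (\<alpha> *\<^sub>R v + \<beta> *\<^sub>R w + \<gamma> *\<^sub>R e) = 0" for \<alpha> \<beta> \<gamma>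
      using u by (simp add: inner_add_right)
    then have "u \<bullet> u = 0" using span[of u] by metis
    with u show False by simp
  qed
  have height: "u \<bullet> (a + \<alpha> *\<^sub>R v + \<beta> *\<^sub>R w + \<gamma> *\<^sub>R e) = k + \<gamma> * (u \<bullet> e)" for \<alpha> \<beta> \<gamma>
    using u by (simp add: inner_add_right)
  have "f x = 0" if "u \<bullet> x = k" for x
  proof -
    obtain \<alpha> \<beta> \<gamma> where "x - a = \<alpha> *\<^sub>R v + \<beta> *\<^sub>R w + \<gamma> *\<^sub>R e" using span by blast
    then have x: "x = a + \<alpha> *\<^sub>R v + \<beta> *\<^sub>R w + \<gamma> *\<^sub>R e" by (simp add: algebra_simps)
    then have "\<gamma> = 0" using that height \<open>u \<bullet> e \<noteq> 0\<close> by simp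
    then show ?thesis using zero x by simp
  qed
  then obtain g where g: "g \<in> polys s" "\<And>x. f x = (u \<bullet> x - k) * g x"
    using polys_division[OF f u(1)] by blast
  show thesis
  proof (rule that[OF g(1)])
    show "\<forall>x. g x = 0 \<Longrightarrow> \<forall>x. f x = 0" using g(2) by simp
    show "vanishes_to_order (N - 1) g x" if "vanishes_to_order N f x" for N x
      by (rule vanishes_to_order_cofactor(2)[OF g that u(1)])
    show "vanishes_to_order N g (a + \<alpha> *\<^sub>R v + \<beta> *\<^sub>R w + \<gamma> *\<^sub>R e)"
      if "\<gamma> \<noteq> 0" "vanishes_to_order N f (a + \<alpha> *\<^sub>R v + \<beta> *\<^sub>R w + \<gamma> *\<^sub>R e)" for N \<alpha> \<beta> \<gamma>
      using vanishes_to_order_cofactor(1)[OF g that(2) u(1)] that(1) \<open>u \<bullet> e \<noteq> 0\<close>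
      by (simp add: height)
  qed
qed

text \<open>In the affine frame with origin \<open>a\<close> and vertices \<open>a + v\<close>, \<open>a + w\<close>,
  \<open>a + e\<close>, the fifth point \<open>b\<close> has coordinates \<open>(\<alpha>, \<beta>,
  \<gamma>)\<close>. The cubic vanishes on the line through \<open>a + e\<close> and \<open>b\<close>, which
  supplies the additional zero in the plane of \<open>a\<close>, \<open>a + v\<close>, \<open>a + w\<close>; the
  conditions on the coordinates put this zero at finite distance and off the sides of the triangle. Dividing by
  that plane leaves a quadric with double points at \<open>a + e\<close> and \<open>b\<close>, and the line
  through \<open>a + w\<close> and \<open>b\<close> does the same for the plane of \<open>a\<close>, \<open>a +
  v\<close>, \<open>a + e\<close>. The remaining factor has degree at most one and a double zero at
  \<open>b\<close>.\<close>

lemma cubic_five_double_points: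
  fixes f :: "real ^ 'd::finite \<Rightarrow> real"
  assumes card: "CARD('d) = 3" and f: "f \<in> polys 4"
    and span: "\<And>x. \<exists>\<alpha> \<beta> \<gamma>. x = \<alpha> *\<^sub>R v + \<beta> *\<^sub>R w + \<gamma> *\<^sub>R e"
    and pos: "\<alpha> \<noteq> 0" "\<beta> \<noteq> 0" "\<gamma> \<noteq> 0" "\<beta> \<noteq> 1" "\<gamma> \<noteq> 1" "\<alpha> + \<beta> + \<gamma> \<noteq> 1"
    and b: "b = a + \<alpha> *\<^sub>R v + \<beta> *\<^sub>R w + \<gamma> *\<^sub>R e"
    and orders: "vanishes_to_order 2 f a" "vanishes_to_order 2 f (a + v)"
      "vanishes_to_order 2 f (a + w)" "vanishes_to_order 2 f (a + e)" "vanishes_to_order 2 f b"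
  shows "\<forall>x. f x = 0"
proof -
  have plane1: "f (a + x *\<^sub>R v + y *\<^sub>R w) = 0" for x y
  proof -
    \<comment> \<open>the parameter at which the line from \<open>a + e\<close> to \<open>b\<close> meets the plane\<close>
    define t where "t = 1 / (1 - \<gamma>)"
    have t: "t * (1 - \<gamma>) = 1" using pos by (simp add: t_def)
    then have te: "(1 - t + t * \<gamma>) = 0" by (simp add: algebra_simps)
    have "f (a + e + t *\<^sub>R (b - (a + e))) = 0"
      by (rule vanishes_on_line[OF f _ orders(4,5)]) simp
    also have "a + e + t *\<^sub>R (b - (a + e)) =
        a + (t * \<alpha>) *\<^sub>R v + (t * \<beta>) *\<^sub>R w + (1 - t + t * \<gamma>) *\<^sub>R e"
      unfolding b by (simp add: algebra_simps)
    finally have z: "f (a + (t * \<alpha>) *\<^sub>R v + (t * \<beta>) *\<^sub>R w) = 0" unfolding te by simp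
    have "t * \<alpha> + t * \<beta> \<noteq> 1"
    proof
      assume "t * \<alpha> + t * \<beta> = 1"
      then have "t * (\<alpha> + \<beta> - (1 - \<gamma>)) = 0" using t by (simp add: algebra_simps)
      then show False using t pos by auto
    qed
    moreover have "t * \<alpha> \<noteq> 0" "t * \<beta> \<noteq> 0" using t pos by auto
    ultimately show ?thesis
      using f orders z by - (rule zero_on_plane[of f 3 "t * \<alpha>" "t * \<beta>" a v w], simp_all)
  qed
  have f': "f \<in> polys (Suc 3)" using f by simp
  obtain g where g: "g \<in> polys 3" "(\<forall>x. g x = 0) \<Longrightarrow> (\<forall>x. f x = 0)"
    "\<And>N x. vanishes_to_order N f x \<Longrightarrow> vanishes_to_order (N - 1) g x"
    and off: "\<And>N \<alpha> \<beta> \<gamma>. \<gamma> \<noteq> 0 \<Longrightarrow> vanishes_to_order N f (a + \<alpha> *\<^sub>R v + \<beta> *\<^sub>R w + \<gamma> *\<^sub>R e) \<Longrightarrow>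
      vanishes_to_order N g (a + \<alpha> *\<^sub>R v + \<beta> *\<^sub>R w + \<gamma> *\<^sub>R e)"
    using split_off_plane[OF card f' span plane1] by blast
  have g_orders: "vanishes_to_order 1 g a" "vanishes_to_order 1 g (a + v)"
      "vanishes_to_order 1 g (a + w)"
    using g(3)[of 2 a] g(3)[of 2 "a + v"] g(3)[of 2 "a + w"] orders by simp_all
  have g_b: "vanishes_to_order 2 g b" using off[of \<gamma>] pos orders(5) unfolding b by blast
  have g_e: "vanishes_to_order 2 g (a + e)" using off[of 1 2 0 0] orders(4) by simp
  have plane2: "g (a + x *\<^sub>R v + y *\<^sub>R e) = 0" for x y
  proof -
    \<comment> \<open>the parameter at which the line from \<open>a + w\<close> to \<open>b\<close> meets the plane\<close>
    define t where "t = 1 / (1 - \<beta>)"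
    have t: "t * (1 - \<beta>) = 1" using pos by (simp add: t_def)
    then have te: "(1 - t + t * \<beta>) = 0" by (simp add: algebra_simps)
    have "g (a + w + t *\<^sub>R (b - (a + w))) = 0"
      by (rule vanishes_on_line[OF g(1) _ g_orders(3) g_b]) simp
    also have "a + w + t *\<^sub>R (b - (a + w)) =
        a + (t * \<alpha>) *\<^sub>R v + (t * \<gamma>) *\<^sub>R e + (1 - t + t * \<beta>) *\<^sub>R w"
      unfolding b by (simp add: algebra_simps)
    finally have z: "g (a + (t * \<alpha>) *\<^sub>R v + (t * \<gamma>) *\<^sub>R e) = 0" unfolding te by simp
    have "t * \<alpha> + t * \<gamma> \<noteq> 1"
    proof
      assume "t * \<alpha> + t * \<gamma> = 1"
      then have "t * (\<alpha> + \<gamma> - (1 - \<beta>)) = 0" using t by (simp add: algebra_simps)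
      then show False using t pos by auto
    qed
    moreover have "t * \<alpha> \<noteq> 0" "t * \<gamma> \<noteq> 0" using t pos by auto
    ultimately show ?thesis
      using g(1) g_orders g_e z by - (rule zero_on_plane[of g 2 "t * \<alpha>" "t * \<gamma>" a v e], simp_all)
  qed
  have g': "g \<in> polys (Suc 2)" using g(1) by simp
  have span': "\<exists>\<alpha> \<beta> \<gamma>. x = \<alpha> *\<^sub>R v + \<beta> *\<^sub>R e + \<gamma> *\<^sub>R w" for x
  proof -
    obtain \<alpha> \<beta> \<gamma> where "x = \<alpha> *\<^sub>R v + \<beta> *\<^sub>R w + \<gamma> *\<^sub>R e" using span by blast
    then have "x = \<alpha> *\<^sub>R v + \<gamma> *\<^sub>R e + \<beta> *\<^sub>R w" by (simp add: algebra_simps)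
    then show ?thesis by blast
  qed
  obtain h where h: "h \<in> polys 2" "(\<forall>x. h x = 0) \<Longrightarrow> (\<forall>x. g x = 0)"
    "\<And>N x. vanishes_to_order N g x \<Longrightarrow> vanishes_to_order (N - 1) h x"
    and off': "\<And>N \<alpha> \<beta> \<gamma>. \<gamma> \<noteq> 0 \<Longrightarrow> vanishes_to_order N g (a + \<alpha> *\<^sub>R v + \<beta> *\<^sub>R e + \<gamma> *\<^sub>R w) \<Longrightarrow>
      vanishes_to_order N h (a + \<alpha> *\<^sub>R v + \<beta> *\<^sub>R e + \<gamma> *\<^sub>R w)"
    using split_off_plane[OF card g' span' plane2] by blast
  have b': "b = a + \<alpha> *\<^sub>R v + \<gamma> *\<^sub>R e + \<beta> *\<^sub>R w" unfolding b by (simp add: algebra_simps)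
  have "vanishes_to_order 2 h b" using off'[of \<beta>] pos g_b unfolding b' by blast
  then have "\<forall>x. h x = 0" using zero_if_vanishes_beyond_degree[OF h(1)] by blast
  then show ?thesis using g(2) h(2) by blast
qed

section \<open>General position holds almost everywhere\<close>

abbreviation lborel_nodes :: "nat set \<Rightarrow> (nat \<Rightarrow> real ^ 'd::finite) measure" where
  "lborel_nodes I \<equiv> (\<Pi>\<^sub>M q\<in>I. lborel)"

lemma product_sigma_finite_lborel:
  "product_sigma_finite (\<lambda>_ :: nat. lborel :: (real ^ 'd::finite) measure)"
  unfolding product_sigma_finite_def using sigma_finite_lborel by blast

lemma emeasure_lborel_translate:
  fixes A :: "(real ^ 'd::finite) set"
  assumes "A \<in> sets borel"
  shows "emeasure lborel ((\<lambda>x. x + v) -` A) = emeasure lborel A"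
proof -
  have "emeasure lborel A = emeasure (distr lborel borel ((+) v)) A"
    by (simp add: lborel_distr_plus)
  also have "\<dots> = emeasure lborel ((+) v -` A)"
    using assms by (subst emeasure_distr) auto
  also have "(+) v = (\<lambda>x. x + v)" by (simp add: fun_eq_iff add.commute)
  finally show ?thesis by simp
qed

text \<open>It suffices to compare the two measures on boxes.\<close>

lemma lborel_nodes_translate:
  fixes V :: "nat \<Rightarrow> real ^ 'd::finite"
  assumes I: "finite I"
  shows "distr (lborel_nodes I) (lborel_nodes I) (\<lambda>X. \<lambda>q\<in>I. X q + V q) = lborel_nodes I"
    (is "distr ?M ?M ?T = ?M")
proof -
  interpret product_sigma_finite "\<lambda>_ :: nat. lborel :: (real ^ 'd) measure"
    by (rule product_sigma_finite_lborel)
  have T: "?T \<in> measurable ?M ?M" by measurable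
  show ?thesis
  proof (rule PiM_eqI[OF I])
    fix A :: "nat \<Rightarrow> (real ^ 'd) set"
    assume A: "\<And>q. q \<in> I \<Longrightarrow> A q \<in> sets lborel"
    have pre: "?T -` (Pi\<^sub>E I A) \<inter> space ?M = Pi\<^sub>E I (\<lambda>q. (\<lambda>x. x + V q) -` A q)"
      by (auto simp: space_PiM PiE_iff)
    have "emeasure (distr ?M ?M ?T) (Pi\<^sub>E I A) = emeasure ?M (?T -` (Pi\<^sub>E I A) \<inter> space ?M)"
      by (rule emeasure_distr[OF T]) (use A I in auto)
    also have "\<dots> = (\<Prod>q\<in>I. emeasure lborel ((\<lambda>x. x + V q) -` A q))"
      unfolding pre
    proof (rule emeasure_PiM[OF I])
      fix q assume "q \<in> I"
      then have "(\<lambda>x. x + V q) -` A q \<inter> space borel \<in> sets borel"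
        using A by (intro measurable_sets[of _ borel borel]) auto
      then show "(\<lambda>x. x + V q) -` A q \<in> sets lborel" by simp
    qed
    also have "\<dots> = (\<Prod>q\<in>I. emeasure lborel (A q))"
      using A by (intro prod.cong) (auto simp: emeasure_lborel_translate)
    finally show "emeasure (distr ?M ?M ?T) (Pi\<^sub>E I A) = (\<Prod>q\<in>I. emeasure lborel (A q))" .
  qed simp
qed

text \<open>Fubini for pairs \<open>(X, t)\<close>: every line in direction \<open>V\<close> meets the exceptional set in
  a null set, so for almost every \<open>t\<close> the translate of the exceptional set by \<open>t V\<close> is
  null. One such \<open>t\<close> suffices, by translation invariance.\<close>

lemma AE_if_finite_exceptions_on_lines:
  fixes V :: "nat \<Rightarrow> real ^ 'd::finite"
  assumes I: "finite I"
    and meas: "{X \<in> space (lborel_nodes I). P X} \<in> sets (lborel_nodes I)"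
    and lines: "\<And>X. finite {t. \<not> P (\<lambda>q\<in>I. X q + t *\<^sub>R V q)}"
  shows "AE X in lborel_nodes I. P X"
proof -
  let ?M = "lborel_nodes I :: (nat \<Rightarrow> real ^ 'd) measure"
  let ?T = "\<lambda>t X. \<lambda>q\<in>I. X q + t *\<^sub>R V q"
  interpret product_sigma_finite "\<lambda>_ :: nat. lborel :: (real ^ 'd) measure"
    by (rule product_sigma_finite_lborel)
  interpret M: sigma_finite_measure ?M by (rule sigma_finite[OF I])
  interpret pair: pair_sigma_finite ?M "lborel :: real measure" ..
  have T2: "(\<lambda>z. ?T (snd z) (fst z)) \<in> measurable (?M \<Otimes>\<^sub>M lborel) ?M" by measurable
  have "{z \<in> space (?M \<Otimes>\<^sub>M lborel). P (?T (snd z) (fst z))} =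
      (\<lambda>z. ?T (snd z) (fst z)) -` {X \<in> space ?M. P X} \<inter> space (?M \<Otimes>\<^sub>M lborel)"
    using measurable_space[OF T2] by auto
  then have joint: "{z \<in> space (?M \<Otimes>\<^sub>M lborel). P (?T (snd z) (fst z))} \<in> sets (?M \<Otimes>\<^sub>M lborel)"
    using measurable_sets[OF T2 meas] by simp
  have "AE t in lborel. P (?T t X)" for X
  proof -
    have "{t. \<not> P (?T t X)} \<in> null_sets lborel"
      using lines[of X] by (rule finite_imp_null_set_lborel)
    then show ?thesis by (rule AE_I') auto
  qed
  then have "AE X in ?M. AE t in lborel. P (?T t X)" by simp
  then have "AE t in lborel. AE X in ?M. P (?T t X)"
    using pair.AE_commute[of "\<lambda>X t. P (?T t X)"] joint by simp
  then obtain N where N: "{t \<in> space lborel. \<not> (AE X in ?M. P (?T t X))} \<subseteq> N"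
    "emeasure lborel N = 0" by (rule AE_E)
  have "\<exists>t :: real. AE X in ?M. P (?T t X)"
  proof (rule ccontr)
    assume "\<nexists>t :: real. AE X in ?M. P (?T t X)"
    with N(1) have "N = UNIV" by auto
    with N(2) show False by simp
  qed
  then obtain t where t: "AE X in ?M. P (?T t X)" ..
  have T: "?T t \<in> measurable ?M ?M" by measurable
  have "AE X in distr ?M ?M (?T t). P X"
    using t by (subst AE_distr_iff[OF T meas])
  then show ?thesis unfolding lborel_nodes_translate[OF I, of "\<lambda>q. t *\<^sub>R V q"] .
qed

text \<open>The determinant is polynomial in \<open>t\<close>. The matrix divided by \<open>t\<close> tends to the unit
  matrix as \<open>t\<close> grows, so the polynomial is not zero.\<close>

lemma finite_roots_det_shift:
  fixes w :: "'d::finite \<Rightarrow> real ^ 'd"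
  shows "finite {t. det (\<chi> i. w i + t *\<^sub>R axis i 1) = 0}"
proof -
  define q :: "real poly" where "q = (\<Sum>p | p permutes UNIV. smult (of_int (sign p))
    (\<Prod>i\<in>UNIV. [:w i $ p i, axis i 1 $ p i:]))"
  have q: "poly q t = det (\<chi> i. w i + t *\<^sub>R axis i 1)" for t
    unfolding q_def det_def by (simp add: poly_sum poly_prod)
  define g :: "real \<Rightarrow> real" where "g s = det (\<chi> i. axis i 1 + s *\<^sub>R w i)" for s
  have "(\<chi> i. axis i 1) = (mat 1 :: real ^ 'd ^ 'd)"
    by (simp add: vec_eq_iff mat_def axis_def)
  then have "g 0 = 1" by (simp add: g_def)
  have "isCont g 0" unfolding g_def det_def by (simp add: continuous_intros)
  then have "eventually (\<lambda>s. g s > 0) (at 0)"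
    using \<open>g 0 = 1\<close> order_tendstoD(1)[of g 1 "at 0" 0] by (simp add: isCont_def)
  then obtain d where d: "d > 0" "\<And>s. s \<noteq> 0 \<Longrightarrow> dist s 0 < d \<Longrightarrow> g s > 0"
    unfolding eventually_at by auto
  define s where "s = d / 2"
  have s: "s \<noteq> 0" "g s \<noteq> 0" using d(1) d(2)[of s] by (auto simp: s_def)
  have "s *s (w i + (1 / s) *\<^sub>R axis i 1) = axis i 1 + s *\<^sub>R w i" for i
    using s(1) by (simp add: vec_eq_iff algebra_simps)
  then have "g s = det (\<chi> i. s *s (w i + (1 / s) *\<^sub>R axis i 1))" by (simp add: g_def)
  also have "\<dots> = s ^ CARD('d) * poly q (1 / s)"
    unfolding q det_rows_mul by simp
  finally have "q \<noteq> 0" using s(2) by auto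
  then show ?thesis unfolding q[symmetric] by (rule poly_roots_finite)
qed

text \<open>Move every node \<open>X (\<sigma> i)\<close> with unit speed in the direction of the \<open>i\<close>-th axis
  and keep the nodes \<open>X (\<tau> i)\<close> fixed: the matrix of differences moves along multiples of the
  unit matrix.\<close>

lemma AE_det_differences:
  fixes \<sigma> \<tau> :: "'d::finite \<Rightarrow> nat"
  assumes I: "finite I" "range \<sigma> \<subseteq> I" "range \<tau> \<subseteq> I" and "inj \<sigma>" "range \<sigma> \<inter> range \<tau> = {}"
  shows "AE X in lborel_nodes I. det (\<chi> i. X (\<sigma> i) - X (\<tau> i) :: real ^ 'd ^ 'd) \<noteq> 0"
proof -
  define V :: "nat \<Rightarrow> real ^ 'd"
    where "V k = (if k \<in> range \<sigma> then axis (inv \<sigma> k) 1 else 0)" for k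
  have V: "V (\<sigma> i) = axis i 1" "V (\<tau> i) = 0" for i
    using assms(4,5) by (auto simp: V_def)
  show ?thesis
  proof (rule AE_if_finite_exceptions_on_lines[OF I(1), where V = V])
    have comp: "(\<lambda>X. X k) \<in> measurable (lborel_nodes I :: (nat \<Rightarrow> real ^ 'd) measure) borel"
      if "k \<in> I" for k
      using measurable_component_singleton[OF that, of "\<lambda>_. lborel"] by simp
    have nth: "(\<lambda>x :: real ^ 'd. x $ j) \<in> borel_measurable borel" for j
      by (intro borel_measurable_continuous_onI continuous_intros)
    have [measurable]: "(\<lambda>X. X k $ j) \<in> borel_measurable (lborel_nodes I :: (nat \<Rightarrow> real ^ 'd) measure)"
      if "k \<in> I" for k j
      using measurable_comp[OF comp[OF that] nth] by (simp add: comp_def)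
    have "\<sigma> i \<in> I" "\<tau> i \<in> I" for i using I by auto
    then have "(\<lambda>X. det (\<chi> i. X (\<sigma> i) - X (\<tau> i) :: real ^ 'd ^ 'd)) \<in> borel_measurable (lborel_nodes I)"
      unfolding det_def by simp
    then show "{X \<in> space (lborel_nodes I). det (\<chi> i. X (\<sigma> i) - X (\<tau> i) :: real ^ 'd ^ 'd) \<noteq> 0}
        \<in> sets (lborel_nodes I)"
      by measurable
  next
    fix X :: "nat \<Rightarrow> real ^ 'd"
    have "\<sigma> i \<in> I" "\<tau> i \<in> I" for i using I by auto
    then have "(\<chi> i. (\<lambda>q\<in>I. X q + t *\<^sub>R V q) (\<sigma> i) - (\<lambda>q\<in>I. X q + t *\<^sub>R V q) (\<tau> i)) =
        (\<chi> i. (X (\<sigma> i) - X (\<tau> i)) + t *\<^sub>R axis i 1)" for t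
      by (simp add: V vec_eq_iff)
    then show "finite {t. \<not> det (\<chi> i. (\<lambda>q\<in>I. X q + t *\<^sub>R V q) (\<sigma> i) -
        (\<lambda>q\<in>I. X q + t *\<^sub>R V q) (\<tau> i)) \<noteq> 0}"
      using finite_roots_det_shift[of "\<lambda>i. X (\<sigma> i) - X (\<tau> i)"] by simp
  qed
qed

lemma det_nonzero_basis:
  fixes w :: "'d::finite \<Rightarrow> real ^ 'd"
  assumes "det (\<chi> i. w i) \<noteq> 0"
  shows "\<exists>c. x = (\<Sum>i\<in>UNIV. c i *\<^sub>R w i)"
    and "(\<Sum>i\<in>UNIV. c i *\<^sub>R w i) = 0 \<Longrightarrow> c i = 0"
proof -
  define A where "A = transpose (\<chi> i. w i)"
  have inv: "invertible A" using assms by (simp add: A_def invertible_det_nz det_transpose)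
  have A: "A *v y = (\<Sum>i\<in>UNIV. y $ i *\<^sub>R w i)" for y
    unfolding matrix_mult_sum A_def column_transpose
    by (simp add: row_def vec_lambda_eta scalar_mult_eq_scaleR)
  from inv obtain B where B: "A ** B = mat 1" "B ** A = mat 1"
    unfolding invertible_def by auto
  have "x = A *v (B *v x)" by (simp add: matrix_vector_mul_assoc B)
  then show "\<exists>c. x = (\<Sum>i\<in>UNIV. c i *\<^sub>R w i)" unfolding A by blast
  assume "(\<Sum>i\<in>UNIV. c i *\<^sub>R w i) = 0"
  then have "A *v (\<chi> i. c i) = 0" by (simp add: A)
  then have "B *v (A *v (\<chi> i. c i)) = 0" by (simp only: matrix_vector_mult_0_right)
  then have "(\<chi> i. c i) = 0" by (simp add: matrix_vector_mul_assoc B)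
  then show "c i = 0" by (simp add: vec_eq_iff)
qed

lemma AE_affinely_spanning:
  assumes card: "CARD('d::finite) = 2" and "finite I" "a \<in> I" "b \<in> I" "c \<in> I"
    "a \<noteq> b" "a \<noteq> c" "b \<noteq> c"
  shows "AE X :: nat \<Rightarrow> real ^ 'd in lborel_nodes I. affinely_spanning (X a) (X b) (X c)"
proof -
  obtain i j :: 'd where ij: "UNIV = {i, j}" "i \<noteq> j"
    using card card_2_iff[of "UNIV :: 'd set"] by auto
  define \<sigma> where "\<sigma> k = (if k = i then b else c)" for k
  have "inj \<sigma>" unfolding inj_def ij(1) using assms ij(2) by (auto simp: \<sigma>_def inj_def split: if_splits)
  then have "AE X in lborel_nodes I. det (\<chi> k. X (\<sigma> k) - X a :: real ^ 'd ^ 'd) \<noteq> 0"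
  proof (intro AE_det_differences[where \<tau> = "\<lambda>_. a"])
    have "\<sigma> k = b \<or> \<sigma> k = c" for k by (auto simp: \<sigma>_def)
    then show "range \<sigma> \<subseteq> I" "range \<sigma> \<inter> range (\<lambda>_ :: 'd. a) = {}"
      using assms(4-7) by fast+
  qed (use assms in auto)
  then show ?thesis
  proof (rule AE_mp, intro AE_I2 impI)
    fix X :: "nat \<Rightarrow> real ^ 'd"
    assume det: "det (\<chi> k. X (\<sigma> k) - X a :: real ^ 'd ^ 'd) \<noteq> 0"
    show "affinely_spanning (X a) (X b) (X c)"
      unfolding affinely_spanning_def
    proof
      fix x
      obtain e where "x - X a = (\<Sum>k\<in>UNIV. e k *\<^sub>R (X (\<sigma> k) - X a))"
        using det_nonzero_basis(1)[OF det] by blast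
      then have "x - X a = e i *\<^sub>R (X b - X a) + e j *\<^sub>R (X c - X a)"
        unfolding ij(1) using ij(2) by (simp add: \<sigma>_def)
      then have "x = (1 - e i - e j) *\<^sub>R X a + e i *\<^sub>R X b + e j *\<^sub>R X c"
        by (simp add: algebra_simps)
      then show "\<exists>r s t. r + s + t = 1 \<and> x = r *\<^sub>R X a + s *\<^sub>R X b + t *\<^sub>R X c"
        by (intro exI[of _ "1 - e i - e j"] exI[of _ "e i"] exI[of _ "e j"]) simp
    qed
  qed
qed

definition basis3 :: "real ^ 'd::finite \<Rightarrow> real ^ 'd \<Rightarrow> real ^ 'd \<Rightarrow> bool" where
  "basis3 u v w \<longleftrightarrow> (\<forall>x. \<exists>\<alpha> \<beta> \<gamma>. x = \<alpha> *\<^sub>R u + \<beta> *\<^sub>R v + \<gamma> *\<^sub>R w) \<and>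
    (\<forall>\<alpha> \<beta> \<gamma>. \<alpha> *\<^sub>R u + \<beta> *\<^sub>R v + \<gamma> *\<^sub>R w = 0 \<longrightarrow> \<alpha> = 0 \<and> \<beta> = 0 \<and> \<gamma> = 0)"

lemma AE_basis3:
  assumes card: "CARD('d::finite) = 3" and "finite I" "{a, b, c, a', b', c'} \<subseteq> I"
    "a \<noteq> b" "a \<noteq> c" "b \<noteq> c" "{a, b, c} \<inter> {a', b', c'} = {}"
  shows "AE X :: nat \<Rightarrow> real ^ 'd in lborel_nodes I. basis3 (X a - X a') (X b - X b') (X c - X c')"
proof -
  obtain i j k :: 'd where ijk: "UNIV = {i, j, k}" "i \<noteq> j" "j \<noteq> k" "i \<noteq> k"
    using card card_3_iff[of "UNIV :: 'd set"] by auto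
  define \<sigma> where "\<sigma> l = (if l = i then a else if l = j then b else c)" for l
  define \<tau> where "\<tau> l = (if l = i then a' else if l = j then b' else c')" for l
  have all: "l = i \<or> l = j \<or> l = k" for l using ijk(1) by auto
  have "inj \<sigma>" unfolding inj_def using assms all by (metis \<sigma>_def)
  then have "AE X in lborel_nodes I. det (\<chi> l. X (\<sigma> l) - X (\<tau> l) :: real ^ 'd ^ 'd) \<noteq> 0"
  proof (intro AE_det_differences)
    have \<sigma>: "\<sigma> l \<in> {a, b, c}" and \<tau>: "\<tau> l \<in> {a', b', c'}" for l
      by (auto simp: \<sigma>_def \<tau>_def)
    show "range \<sigma> \<subseteq> I" using \<sigma> assms(3) by fast
    show "range \<tau> \<subseteq> I" using \<tau> assms(3) by fast
    have "\<sigma> l \<noteq> \<tau> l'" for l l' using \<sigma>[of l] \<tau>[of l'] assms(7) by fast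
    then show "range \<sigma> \<inter> range \<tau> = {}" by fast
  qed (rule assms(2))
  then show ?thesis
  proof (rule AE_mp, intro AE_I2 impI)
    fix X :: "nat \<Rightarrow> real ^ 'd"
    assume det: "det (\<chi> l. X (\<sigma> l) - X (\<tau> l) :: real ^ 'd ^ 'd) \<noteq> 0"
    have sum: "(\<Sum>l\<in>UNIV. e l *\<^sub>R (X (\<sigma> l) - X (\<tau> l))) =
        e i *\<^sub>R (X a - X a') + e j *\<^sub>R (X b - X b') + e k *\<^sub>R (X c - X c')" for e
      unfolding ijk(1) using ijk(2-4) by (simp add: \<sigma>_def \<tau>_def)
    show "basis3 (X a - X a') (X b - X b') (X c - X c')"
      unfolding basis3_def
    proof (intro conjI allI impI)
      show "\<exists>\<alpha> \<beta> \<gamma>. x = \<alpha> *\<^sub>R (X a - X a') + \<beta> *\<^sub>R (X b - X b') + \<gamma> *\<^sub>R (X c - X c')" for x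
        using det_nonzero_basis(1)[OF det, of x] unfolding sum by blast
    next
      fix \<alpha> \<beta> \<gamma>
      assume 0: "\<alpha> *\<^sub>R (X a - X a') + \<beta> *\<^sub>R (X b - X b') + \<gamma> *\<^sub>R (X c - X c') = 0"
      define e where "e l = (if l = i then \<alpha> else if l = j then \<beta> else \<gamma>)" for l
      have e: "e i = \<alpha>" "e j = \<beta>" "e k = \<gamma>" using ijk(2-4) by (auto simp: e_def)
      have "e l = 0" for l
        using det_nonzero_basis(2)[OF det, of e l] 0 unfolding sum e by simp
      with e show "\<alpha> = 0" "\<beta> = 0" "\<gamma> = 0" by auto
    qed
  qed
qed

section \<open>Numerical analysis of the unobstructed schemes\<close>

lemma double_choose_two: "2 * ((k + 2) choose 2) = (k + 2) * (k + 1)"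
proof -
  have "even ((k + 2) * (k + 1))" by simp
  then show ?thesis by (simp add: choose_two)
qed

lemma consecutive_product_inject:
  assumes "(n + 2) * (n + 1) = (c + 2) * (c + 1 :: nat)"
  shows "n = c"
proof (rule ccontr)
  assume "n \<noteq> c"
  then consider "n < c" | "c < n" by linarith
  then show False
  proof cases
    case 1
    then have "(n + 2) * (n + 1) < (c + 2) * (c + 1)" by (intro mult_strict_mono) auto
    with assms show False by simp
  next
    case 2
    then have "(c + 2) * (c + 1) < (n + 2) * (n + 1)" by (intro mult_strict_mono) auto
    with assms show False by simp
  qed
qed

lemma atLeastAtMost_1_4: "{1..4 :: nat} = {1, 2, 3, 4}"
  and atLeastAtMost_1_5: "{1..5 :: nat} = {1, 2, 3, 4, 5}"
  by auto

lemma four_node_count: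
  assumes "(n + 2) choose 2 = (\<Sum>q=1..4. (p q + 2) choose 2)"
  shows "(n + 2) * (n + 1) = (p 1 + 2) * (p 1 + 1) + (p 2 + 2) * (p 2 + 1) +
    (p 3 + 2) * (p 3 + 1) + (p (4::nat) + 2) * (p 4 + 1)"
proof -
  have "2 * ((n + 2) choose 2) = 2 * (\<Sum>q=1..4. (p q + 2) choose 2)" using assms by simp
  then show ?thesis
    unfolding atLeastAtMost_1_4 by (simp only: sum_distrib_left double_choose_two) simp
qed

text \<open>The orders are sorted, so all nodes but the last one satisfy \<open>2 * Suc (p q) \<le> n + 1\<close>.
  Comparing the resulting upper bound for the sum of the orders with the lower bound \<open>d * n + 1\<close>
  leaves the plane, where both bounds differ by one, the case \<open>n = 1\<close>, and finitely many pairs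
  \<open>(d, n)\<close>. The dimension count is needed to exclude equal orders in the plane and simple nodes in
  degree one.\<close>

lemma exceptional_if_unobstructed:
  fixes p :: "nat \<Rightarrow> nat"
  assumes d: "d \<ge> 2" and mono: "mono_on {1..d + 2} p"
    and count: "(n + d) choose d = (\<Sum>q=1..d + 2. (p q + d) choose d)"
    and lines: "\<And>a b. a \<in> {1..d + 2} \<Longrightarrow> b \<in> {1..d + 2} \<Longrightarrow> a \<noteq> b \<Longrightarrow> p a + p b < n"
    and planes: "d * n < (\<Sum>q=1..d + 2. Suc (p q))"
  shows "d = 2 \<and> (p 1 = p 2 \<and> p 2 = p 3 \<and> p 4 = p 3 + 1 \<or>
      p 1 + 1 = p 2 \<and> p 2 = p 3 \<and> p 3 = p 4) \<or>
    d = 3 \<and> (\<forall>q\<in>{1..5}. p q = 1) \<and> n = 3"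
proof (cases "d = 2")
  case True
  have ord: "p 1 \<le> p 2" "p 2 \<le> p 3" "p 3 \<le> p 4"
    using True by (auto intro!: monotone_onD[OF mono])
  have pairs: "p 3 + p 4 < n" using lines[of 3 4] True by simp
  have sum: "2 * n < p 1 + p 2 + p 3 + p 4 + 4"
  proof -
    have "2 * n < (\<Sum>q=1..4. Suc (p q))" using planes True by simp
    then show ?thesis unfolding atLeastAtMost_1_4 by simp
  qed
  have "\<not> (p 1 = p 2 \<and> p 2 = p 3 \<and> p 3 = p 4)"
  proof
    assume eq: "p 1 = p 2 \<and> p 2 = p 3 \<and> p 3 = p 4"
    then have "n = 2 * p 1 + 1" using pairs sum by auto
    moreover have "(n + 2) * (n + 1) = 4 * ((p 1 + 2) * (p 1 + 1))"
      using four_node_count[of n p] count True eq by simp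
    ultimately show False by (simp add: algebra_simps)
  qed
  then show ?thesis using True ord pairs sum by auto
next
  case False
  then have d3: "d \<ge> 3" using d by simp
  define k where "k = Suc (p (d + 1))"
  have le: "p q \<le> p (d + 1)" if "q \<in> {1..d}" for q
    using that by (intro monotone_onD[OF mono]) auto
  have le': "p (d + 1) \<le> p (d + 2)" by (intro monotone_onD[OF mono]) auto
  have top: "p (d + 1) + p (d + 2) < n" using lines[of "d + 1" "d + 2"] by simp
  have "(\<Sum>q=1..d. Suc (p q)) \<le> d * k"
    using sum_bounded_above[of "{1..d}" "\<lambda>q. Suc (p q)" k] le by (simp add: k_def)
  then have upper: "d * n < d * k + n + 1" using planes top by (simp add: k_def)
  have "2 * k \<le> n + 1" using top le' by (simp add: k_def)
  then have "d * (2 * k) \<le> d * (n + 1)" by (rule mult_le_mono2)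
  then have bound: "d * n \<le> d + 2 * n" using upper by (simp add: algebra_simps)
  have "n \<noteq> 1"
  proof
    assume n: "n = 1"
    have p0: "p q = 0" if "q \<in> {1..d + 2}" for q
    proof -
      have "q \<in> {1..d} \<or> q = d + 1 \<or> q = d + 2" using that by auto
      then show ?thesis using le top n by auto
    qed
    have "(\<Sum>q=1..d + 2. (p q + d) choose d) = (\<Sum>q=1..d + 2. 1)"
      by (intro sum.cong) (simp_all add: p0)
    with count n show False by simp
  qed
  then have "n \<ge> 2" using top by simp
  then obtain x y where xy: "d = x + 3" "n = y + 2"
    using d3 by (metis add.commute le_Suc_ex)
  have "(x + 1) * (y + 1) \<le> 2" using bound unfolding xy by (simp add: algebra_simps)
  then have "x * y + x + y \<le> 1" by (simp add: algebra_simps)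
  then consider "x = 0" "y = 0" | "x = 1" "y = 0" | "x = 0" "y = 1"
    by (cases x; cases y) auto
  then show ?thesis
  proof cases
    case 1
    then show ?thesis using xy upper \<open>2 * k \<le> n + 1\<close> by simp
  next
    case 2
    then have "k \<le> 1" using xy \<open>2 * k \<le> n + 1\<close> by simp
    then show ?thesis using xy 2 upper by simp
  next
    case 3
    then have dn: "d = 3" "n = 3" using xy by simp_all
    have "k = 2" using upper \<open>2 * k \<le> n + 1\<close> dn by simp
    then have p45: "p 4 = 1" "p 5 = 1" using top le' dn by (auto simp: k_def)
    have "p 1 \<le> 1" "p 2 \<le> 1" "p 3 \<le> 1" using le[of 1] le[of 2] le[of 3] dn p45 by simp_all
    moreover have "9 < Suc (p 1) + Suc (p 2) + Suc (p 3) + Suc (p 4) + Suc (p 5)"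
    proof -
      have "9 < (\<Sum>q=1..5. Suc (p q))" using planes dn by simp
      then show ?thesis unfolding atLeastAtMost_1_5 by simp
    qed
    ultimately have "p 1 = 1" "p 2 = 1" "p 3 = 1" using p45 by linarith+
    then show ?thesis using dn p45 unfolding atLeastAtMost_1_5 by auto
  qed
qed

section \<open>Regular and singular schemes on d + 2 nodes\<close>

text \<open>The dimension count determines \<open>n\<close> from the orders, since \<open>(n + 2) * (n + 1)\<close> is
  strictly monotone in \<open>n\<close>.\<close>

lemma hermite_regular_quadrangle:
  fixes X :: "nat \<Rightarrow> real ^ 'd::finite"
  assumes card: "CARD('d) = 2" and quad: "quadrangle (X 1) (X 2) (X 3) (X 4)"
    and p: "p 1 = p 2 \<and> p 2 = p 3 \<and> p 4 = p 3 + 1 \<or> p 1 + 1 = p 2 \<and> p 2 = p 3 \<and> p 3 = p 4"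
    and count: "(n + 2) choose 2 = (\<Sum>q=1..4. (p q + 2) choose 2)"
  shows "hermite_regular n 4 p X"
proof (rule hermite_regular_if_kernel_0)
  show "(n + CARD('d)) choose CARD('d) = (\<Sum>q=1..4. (p q + CARD('d)) choose CARD('d))"
    using count card by simp
  fix f :: "real ^ 'd \<Rightarrow> real"
  assume f: "f \<in> polys (Suc n)"
    and derivs: "\<And>q \<alpha>. q \<in> {1..4} \<Longrightarrow> \<alpha> \<in> multi_indices (p q) \<Longrightarrow> mixed_deriv \<alpha> f (X q) = 0"
  have order: "vanishes_to_order (Suc (p q)) f (X q)" if "q \<in> {1..4}" for q
    using that by (intro vanishes_to_order_if_derivs_0[OF f] derivs)
  note count' = four_node_count[OF count]
  from p show "\<forall>x. f x = 0"
  proof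
    assume p: "p 1 = p 2 \<and> p 2 = p 3 \<and> p 4 = p 3 + 1"
    then have p': "p 2 = p 1" "p 3 = p 1" "p 4 = p 1 + 1" by auto
    have "(n + 2) * (n + 1) = (2 * p 1 + 2 + 2) * (2 * p 1 + 2 + 1)"
      using count' unfolding p' by (simp add: algebra_simps)
    then have "n = 2 * p 1 + 2" by (rule consecutive_product_inject)
    then have "f \<in> polys (2 * Suc (p 1) + 1)" using f by simp
    then show ?thesis
      using order[of 1] order[of 2] order[of 3] order[of 4] p'
      by (intro quadrangle_unisolvent_A[OF card quad]) simp_all
  next
    assume p: "p 1 + 1 = p 2 \<and> p 2 = p 3 \<and> p 3 = p 4"
    then have p': "p 2 = p 1 + 1" "p 3 = p 1 + 1" "p 4 = p 1 + 1" by auto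
    have "(n + 2) * (n + 1) = (2 * p 1 + 3 + 2) * (2 * p 1 + 3 + 1)"
      using count' unfolding p' by (simp add: algebra_simps)
    then have "n = 2 * p 1 + 3" by (rule consecutive_product_inject)
    then have "Suc n = 2 * (p 1 + 2)" by simp
    then have f': "f \<in> polys (2 * (p 1 + 2))" using f by metis
    have quad': "quadrangle (X 2) (X 3) (X 4) (X 1)"
      using quad unfolding quadrangle_def by (auto intro: affinely_spanning_perms)
    show ?thesis
      using order[of 1] order[of 2] order[of 3] order[of 4] p'
      by (intro quadrangle_unisolvent_B[OF card quad' f']) simp_all
  qed
qed

lemma almost_regular_dim_2:
  assumes card: "CARD('d::finite) = 2"
    and p: "p 1 = p 2 \<and> p 2 = p 3 \<and> p 4 = p 3 + 1 \<or> p 1 + 1 = p 2 \<and> p 2 = p 3 \<and> p 3 = p 4"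
    and count: "(n + 2) choose 2 = (\<Sum>q=1..4. (p q + 2) choose 2)"
  shows "almost_regular TYPE('d) n 4 p"
  unfolding almost_regular_def
proof -
  have span: "AE X :: nat \<Rightarrow> real ^ 'd in lborel_nodes {1..4}. affinely_spanning (X a) (X b) (X c)"
    if "a \<in> {1..4}" "b \<in> {1..4}" "c \<in> {1..4}" "a \<noteq> b" "a \<noteq> c" "b \<noteq> c" for a b c
    using that by (intro AE_affinely_spanning[OF card]) auto
  have "AE X :: nat \<Rightarrow> real ^ 'd in lborel_nodes {1..4}. quadrangle (X 1) (X 2) (X 3) (X 4)"
    unfolding quadrangle_def by (intro AE_conjI span) auto
  then show "AE X :: nat \<Rightarrow> real ^ 'd in lborel_nodes {1..4}. hermite_regular n 4 p X"
    by (rule AE_mp) (auto intro!: AE_I2 hermite_regular_quadrangle[OF card _ p count])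
qed

text \<open>The first basis is the affine frame with origin \<open>X 1\<close>. In this frame each of the other six
  conditions excludes one affine relation for the coordinates \<open>\<alpha>\<close>, \<open>\<beta>\<close>,
  \<open>\<gamma>\<close> of \<open>X 5\<close>: the vanishing of a coordinate, \<open>\<beta> = 1\<close>,
  \<open>\<gamma> = 1\<close>, and \<open>\<alpha> + \<beta> + \<gamma> = 1\<close>.\<close>

lemma hermite_regular_five_double_points:
  fixes X :: "nat \<Rightarrow> real ^ 'd::finite"
  assumes card: "CARD('d) = 3" and p: "\<forall>q\<in>{1..5}. p q = 1"
    and bases: "basis3 (X 2 - X 1) (X 3 - X 1) (X 4 - X 1)"
      "basis3 (X 5 - X 1) (X 3 - X 1) (X 4 - X 1)" "basis3 (X 2 - X 1) (X 5 - X 1) (X 4 - X 1)"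
      "basis3 (X 2 - X 1) (X 3 - X 1) (X 5 - X 1)" "basis3 (X 2 - X 1) (X 5 - X 3) (X 4 - X 1)"
      "basis3 (X 2 - X 1) (X 3 - X 1) (X 5 - X 4)" "basis3 (X 3 - X 2) (X 4 - X 2) (X 5 - X 2)"
  shows "hermite_regular 3 5 p X"
proof (rule hermite_regular_if_kernel_0)
  have "(6::nat) choose 3 = 20" by (simp add: numeral_eq_Suc)
  moreover have "(\<Sum>q=1..5. (p q + 3) choose 3) = (\<Sum>q=1..5::nat. 4)"
    using p by (intro sum.cong) (auto simp: numeral_eq_Suc)
  ultimately show "(3 + CARD('d)) choose CARD('d) = (\<Sum>q=1..5. (p q + CARD('d)) choose CARD('d))"
    using card by simp
  fix f :: "real ^ 'd \<Rightarrow> real"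
  assume f: "f \<in> polys (Suc 3)"
    and derivs: "\<And>q \<alpha>. q \<in> {1..5} \<Longrightarrow> \<alpha> \<in> multi_indices (p q) \<Longrightarrow> mixed_deriv \<alpha> f (X q) = 0"
  have order: "vanishes_to_order 2 f (X q)" if "q \<in> {1..5}" for q
    using vanishes_to_order_if_derivs_0[OF f derivs[OF that]] that p by (simp add: numeral_2_eq_2)
  define v w e where vwe: "v = X 2 - X 1" "w = X 3 - X 1" "e = X 4 - X 1"
  obtain \<alpha> \<beta> \<gamma> where b: "X 5 - X 1 = \<alpha> *\<^sub>R v + \<beta> *\<^sub>R w + \<gamma> *\<^sub>R e"
    using bases(1) unfolding basis3_def vwe by blast
  have indep: False if "basis3 x y z" "r *\<^sub>R x + s *\<^sub>R y + t *\<^sub>R z = 0" "r \<noteq> 0 \<or> s \<noteq> 0 \<or> t \<noteq> 0"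
    for x y z :: "real ^ 'd" and r s t
    using that unfolding basis3_def by blast
  have "\<alpha> \<noteq> 0"
    using indep[OF bases(2), of 1 "- \<beta>" "- \<gamma>"] b by (auto simp: vwe)
  moreover have "\<beta> \<noteq> 0"
    using indep[OF bases(3), of "- \<alpha>" 1 "- \<gamma>"] b by (auto simp: vwe)
  moreover have "\<gamma> \<noteq> 0"
    using indep[OF bases(4), of "- \<alpha>" "- \<beta>" 1] b by (auto simp: vwe)
  moreover have "\<beta> \<noteq> 1"
  proof
    assume "\<beta> = 1"
    then have "X 5 - X 3 = \<alpha> *\<^sub>R v + \<gamma> *\<^sub>R e" using b by (simp add: vwe algebra_simps)
    then show False using indep[OF bases(5), of "- \<alpha>" 1 "- \<gamma>"] by (simp add: vwe)
  qed
  moreover have "\<gamma> \<noteq> 1"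
  proof
    assume "\<gamma> = 1"
    then have "X 5 - X 4 = \<alpha> *\<^sub>R v + \<beta> *\<^sub>R w" using b by (simp add: vwe algebra_simps)
    then show False using indep[OF bases(6), of "- \<alpha>" "- \<beta>" 1] by (simp add: vwe)
  qed
  moreover have "\<alpha> + \<beta> + \<gamma> \<noteq> 1"
  proof
    assume "\<alpha> + \<beta> + \<gamma> = 1"
    then have \<alpha>: "\<alpha> = 1 - \<beta> - \<gamma>" by simp
    have "X 5 - X 2 = \<beta> *\<^sub>R (X 3 - X 2) + \<gamma> *\<^sub>R (X 4 - X 2)"
      using b unfolding \<alpha> by (simp add: vwe algebra_simps)
    then show False using indep[OF bases(7), of "- \<beta>" "- \<gamma>" 1] by simp
  qed
  moreover have "X 5 = X 1 + \<alpha> *\<^sub>R v + \<beta> *\<^sub>R w + \<gamma> *\<^sub>R e" using b by (simp add: algebra_simps)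
  moreover have "\<exists>\<alpha> \<beta> \<gamma>. x = \<alpha> *\<^sub>R v + \<beta> *\<^sub>R w + \<gamma> *\<^sub>R e" for x
    using bases(1) unfolding basis3_def vwe by blast
  moreover have "f \<in> polys 4" using f by simp
  moreover have "X 1 + v = X 2" "X 1 + w = X 3" "X 1 + e = X 4" by (simp_all add: vwe)
  ultimately show "\<forall>x. f x = 0"
    using order[of 1] order[of 2] order[of 3] order[of 4] order[of 5]
    by - (rule cubic_five_double_points[OF card, of f v w e \<alpha> \<beta> \<gamma> "X 5" "X 1"], simp_all)
qed

lemma almost_regular_dim_3:
  assumes card: "CARD('d::finite) = 3" and p: "\<forall>q\<in>{1..5}. p q = 1"
  shows "almost_regular TYPE('d) 3 5 p"
  unfolding almost_regular_def
proof -
  have basis: "AE X :: nat \<Rightarrow> real ^ 'd in lborel_nodes {1..5}.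
      basis3 (X a - X a') (X b - X b') (X c - X c')"
    if "{a, b, c, a', b', c'} \<subseteq> {1..5}" "a \<noteq> b" "a \<noteq> c" "b \<noteq> c" "{a, b, c} \<inter> {a', b', c'} = {}"
    for a b c a' b' c'
    using that by (intro AE_basis3[OF card]) auto
  have "AE X :: nat \<Rightarrow> real ^ 'd in lborel_nodes {1..5}.
      basis3 (X 2 - X 1) (X 3 - X 1) (X 4 - X 1) \<and>
      basis3 (X 5 - X 1) (X 3 - X 1) (X 4 - X 1) \<and> basis3 (X 2 - X 1) (X 5 - X 1) (X 4 - X 1) \<and>
      basis3 (X 2 - X 1) (X 3 - X 1) (X 5 - X 1) \<and> basis3 (X 2 - X 1) (X 5 - X 3) (X 4 - X 1) \<and>
      basis3 (X 2 - X 1) (X 3 - X 1) (X 5 - X 4) \<and> basis3 (X 3 - X 2) (X 4 - X 2) (X 5 - X 2)"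
    by (intro AE_conjI basis) auto
  then show "AE X :: nat \<Rightarrow> real ^ 'd in lborel_nodes {1..5}. hermite_regular 3 5 p X"
    by (rule AE_mp) (auto intro!: AE_I2 hermite_regular_five_double_points[OF card p])
qed

lemma singular_scheme_if_not_exceptional:
  assumes d: "CARD('d::finite) \<ge> 2" and m: "m = CARD('d) + 2" and mono: "mono_on {1..m} p"
    and count: "(n + CARD('d)) choose CARD('d) = (\<Sum>q=1..m. (p q + CARD('d)) choose CARD('d))"
    and not_exceptional: "\<not> (CARD('d) = 2 \<and> (p 1 = p 2 \<and> p 2 = p 3 \<and> p 4 = p 3 + 1 \<or>
        p 1 + 1 = p 2 \<and> p 2 = p 3 \<and> p 3 = p 4))"
      "\<not> (CARD('d) = 3 \<and> (\<forall>q\<in>{1..5}. p q = 1) \<and> n = 3)"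
  shows "singular_scheme TYPE('d) n m p"
  unfolding singular_scheme_def
proof (intro allI impI)
  fix X :: "nat \<Rightarrow> real ^ 'd"
  assume inj: "inj_on X {1..m}"
  show "\<not> hermite_regular n m p X"
  proof (cases "\<exists>a\<in>{1..m}. \<exists>b\<in>{1..m}. a \<noteq> b \<and> n \<le> p a + p b")
    case True
    then obtain a b where "a \<in> {1..m}" "b \<in> {1..m}" "a \<noteq> b" "n \<le> p a + p b" by blast
    then show ?thesis
      using inj by (intro not_hermite_regular_if_line_overdetermined[of a m b]) (auto dest: inj_onD)
  next
    case False
    then have lines: "p a + p b < n" if "a \<in> {1..m}" "b \<in> {1..m}" "a \<noteq> b" for a b
      using that by (meson not_le)
    show ?thesis
    proof (rule not_hermite_regular_if_hyperplanes)
      fix q assume q: "q \<in> {1..m}"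
      define r where "r = (if q = 1 then 2 else 1 :: nat)"
      have "r \<in> {1..m}" "q \<noteq> r" using m by (auto simp: r_def)
      then show "Suc (p q) \<le> n" using lines[OF q, of r] by simp
    next
      show "(\<Sum>q=1..m. Suc (p q)) \<le> CARD('d) * n"
      proof (rule ccontr)
        assume "\<not> ?thesis"
        then have "CARD('d) * n < (\<Sum>q=1..m. Suc (p q))" by (simp only: not_le)
        then show False
          using exceptional_if_unobstructed[OF d, of p n] mono count lines not_exceptional
          unfolding m by blast
      qed
    qed
  qed
qed

theorem theorem7:
  fixes p :: "nat \<Rightarrow> nat" and n m :: nat
  assumes "CARD('d::finite) \<ge> 2"
    and "m = CARD('d) + 2"
    and "mono_on {1..m} p"
    and "(n + CARD('d)) choose CARD('d) = (\<Sum>q=1..m. (p q + CARD('d)) choose CARD('d))"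
  shows
    "(CARD('d) = 2 \<and>
        (p 1 = p 2 \<and> p 2 = p 3 \<and> p 4 = p 3 + 1 \<or>
         p 1 + 1 = p 2 \<and> p 2 = p 3 \<and> p 3 = p 4)
      \<longrightarrow> almost_regular TYPE('d) n m p) \<and>
     (CARD('d) = 3 \<and> (\<forall>q\<in>{1..5}. p q = 1) \<and> n = 3
      \<longrightarrow> almost_regular TYPE('d) n m p) \<and>
     (\<not> (CARD('d) = 2 \<and>
        (p 1 = p 2 \<and> p 2 = p 3 \<and> p 4 = p 3 + 1 \<or>
         p 1 + 1 = p 2 \<and> p 2 = p 3 \<and> p 3 = p 4)) \<and>
      \<not> (CARD('d) = 3 \<and> (\<forall>q\<in>{1..5}. p q = 1) \<and> n = 3)
      \<longrightarrow> singular_scheme TYPE('d) n m p)"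
proof (intro conjI impI)
  assume A: "CARD('d) = 2 \<and>
        (p 1 = p 2 \<and> p 2 = p 3 \<and> p 4 = p 3 + 1 \<or>
         p 1 + 1 = p 2 \<and> p 2 = p 3 \<and> p 3 = p 4)"
  then have "m = 4" using assms(2) by simp
  then show "almost_regular TYPE('d) n m p"
    using almost_regular_dim_2[where 'd = 'd, of p n] A assms(4) by simp
next
  assume A: "CARD('d) = 3 \<and> (\<forall>q\<in>{1..5}. p q = 1) \<and> n = 3"
  then have "m = 5" using assms(2) by simp
  then show "almost_regular TYPE('d) n m p"
    using almost_regular_dim_3[where 'd = 'd, of p] A by simp
next
  assume "\<not> (CARD('d) = 2 \<and>
        (p 1 = p 2 \<and> p 2 = p 3 \<and> p 4 = p 3 + 1 \<or>
         p 1 + 1 = p 2 \<and> p 2 = p 3 \<and> p 3 = p 4)) \<and>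
      \<not> (CARD('d) = 3 \<and> (\<forall>q\<in>{1..5}. p q = 1) \<and> n = 3)"
  then show "singular_scheme TYPE('d) n m p"
    using singular_scheme_if_not_exceptional[where 'd = 'd, OF assms] by blast
qed

end
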